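(* Fix $A>0$ and $p,q>1$. If $\{e_n\}_{n=1}^{\infty}\subset L^2(\mathbb{R})$ satisfies $\|e_n\|_2=1$ for all $n$ and $$\forall n\in\mathbb{N},\quad |\mu_p(e_n)|\leq A,\quad |\Delta_p(e_n)|\leq A,\quad\text{and}\quad |\Delta_q(\widehat{e_n})|\leq A,$$ then $\{e_n\}_{n=1}^{\infty}$ cannot be a frame for $L^2(\mathbb{R})$.
   Context: The Fourier transform on $L^2(\mathbb{R})$ is normalized by $\widehat{f}(\xi)=\int f(t)e^{-2\pi i t\xi}\,dt$. For $p>1$ and $h\in L^2(\mathbb{R})$ with $\|h\|_2=1$, the $p$-dispersion of $h$ is $\Delta_p(h)=\min_{a\in\mathbb{R}}\left(\int|t-a|^p|h(t)|^2\,dt\right)^{1/2}$ (equal to $\infty$ if $\int|t|^p|h(t)|^2\,dt=\infty$). When $\Delta_p(h)$ is finite, the $p$-mean $\mu_p(h)$ is the unique $a\in\mathbb{R}$ attaining this minimum (uniqueness holds by strict convexity since $p>1$). A bound such as $|\mu_p(h)|\le A$ or $\Delta_p(h)\le A$ includes the requirement that the quantity be defined and finite. A system $\{e_n\}_{n=1}^\infty$ in a Hilbert space $H$ is a frame for $H$ if there exist constants $0<a,b<\infty$ such that $a\|f\|^2\le\sum_{n=1}^\infty|\langle f,e_n\rangle|^2\le b\|f\|^2$ for all $f\in H$. *)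

theory Defs
  imports "HOL-Analysis.Analysis"
begin

(* Elements of L^2(R) are represented by Borel functions real => complex. Every a.e. class has
   a Borel representative, and every notion below depends only on the a.e. class. *)

definition L2 :: "(real \<Rightarrow> complex) set" where
  "L2 = {f \<in> borel_measurable lborel. integrable lborel (\<lambda>t. (cmod (f t))\<^sup>2)}"

definition L2_norm :: "(real \<Rightarrow> complex) \<Rightarrow> real" where
  "L2_norm f = sqrt (LINT t|lborel. (cmod (f t))\<^sup>2)"

definition L2_inner :: "(real \<Rightarrow> complex) \<Rightarrow> (real \<Rightarrow> complex) \<Rightarrow> complex" where
  "L2_inner f g = (LINT t|lborel. f t * cnj (g t))"

definition truncated_fourier :: "real \<Rightarrow> (real \<Rightarrow> complex) \<Rightarrow> real \<Rightarrow> complex" where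
  "truncated_fourier R f \<xi> =
     (LINT t:{-R..R}|lborel. f t * exp (- (2 * complex_of_real pi * \<i> * complex_of_real (t * \<xi>))))"

(* The integral defining the Fourier transform of f in L^2(R) need not converge absolutely, so
   the transform is the L^2-limit of the Fourier integrals of the truncations of f. It is
   determined only up to null sets, hence a relation: g represents the transform of f. *)
definition has_L2_fourier_transform :: "(real \<Rightarrow> complex) \<Rightarrow> (real \<Rightarrow> complex) \<Rightarrow> bool" where
  "has_L2_fourier_transform f g \<longleftrightarrow> f \<in> L2 \<and> g \<in> L2 \<and>
     ((\<lambda>R. \<integral>\<^sup>+ \<xi>. ennreal ((cmod (truncated_fourier R f \<xi> - g \<xi>))\<^sup>2) \<partial>lborel) \<longlongrightarrow> 0) at_top"

definition dispersion_about :: "real \<Rightarrow> (real \<Rightarrow> complex) \<Rightarrow> real \<Rightarrow> ennreal" where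
  "dispersion_about p h a =
     (let I = \<integral>\<^sup>+ t. ennreal (\<bar>t - a\<bar> powr p * (cmod (h t))\<^sup>2) \<partial>lborel
      in if I = \<infinity> then \<infinity> else ennreal (sqrt (enn2real I)))"

(* For p > 1 and h in L^2 of norm 1 the infimum is attained (the integral is infinite
   either for every a or for none; in the latter case it is continuous and coercive in a). *)
definition dispersion :: "real \<Rightarrow> (real \<Rightarrow> complex) \<Rightarrow> ennreal" where
  "dispersion p h = (INF a. dispersion_about p h a)"

(* Meaningful only when dispersion p h is finite. *)
definition p_mean :: "real \<Rightarrow> (real \<Rightarrow> complex) \<Rightarrow> real" where
  "p_mean p h = (THE a. dispersion_about p h a = dispersion p h)"

(* The series has nonnegative terms and is summed in [0, \<infinity>], so the upper bound
   includes its convergence. *)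
definition L2_frame :: "(nat \<Rightarrow> real \<Rightarrow> complex) \<Rightarrow> bool" where
  "L2_frame e \<longleftrightarrow> (\<forall>n. e n \<in> L2) \<and>
     (\<exists>a b :: real. 0 < a \<and> 0 < b \<and>
       (\<forall>f\<in>L2. ennreal (a * (L2_norm f)\<^sup>2) \<le> (\<Sum>n. ennreal ((cmod (L2_inner f (e n)))\<^sup>2)) \<and>
                (\<Sum>n. ennreal ((cmod (L2_inner f (e n)))\<^sup>2)) \<le> ennreal (b * (L2_norm f)\<^sup>2)))"

end

theory Submission
  imports Defs "HOL-Probability.Characteristic_Functions"
begin

text \<open>
  Suppose that the \<open>e n\<close> form a frame. Their time localisation is uniform: the \<open>p\<close>-means are
  bounded and the \<open>p\<close>-dispersions too, so by Chebyshev one interval \<open>[-T, T]\<close> carries nearly all of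
  the energy of every \<open>e n\<close>. In frequency each \<open>e n\<close> lives near some point \<open>b n\<close>, with the same
  spread for all \<open>n\<close>, but the points \<open>b n\<close> are arbitrary. The proof compares two consequences.

  The upper frame bound limits how often the points \<open>b n\<close> can accumulate. Apply it to the exponential
  of frequency \<open>\<xi>\<close> cut off to \<open>[-T, T]\<close>: its coefficients are the values at \<open>\<xi>\<close> of the truncated
  Fourier transforms of the \<open>e n\<close>, so their squares add up to at most \<open>2 T \<beta>\<close>. Integrate this against
  the weight \<open>(1 + |\<xi>|)\<^sup>-\<^sup>q\<close>, which is integrable because \<open>q > 1\<close>. Plancherel's theorem shows that
  the truncated transform of \<open>e n\<close> has energy at least \<open>1/2\<close> close to \<open>b n\<close>
  (\<open>local_energy_ge_half\<close>), so the sum of \<open>(1 + |b n|)\<^sup>-\<^sup>q\<close> over \<open>n\<close> is finite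
  (\<open>summable_frequency_weights\<close>).

  The lower frame bound is then violated by unit vectors with spectrum in \<open>[0, 1]\<close> that escape to
  infinity in time, that is, by the modulations \<open>exp(2 \<pi> i m \<xi>)\<close> of the indicator of \<open>[0, 1]\<close> on the
  frequency side. By Parseval's formula their coefficient against \<open>e n\<close> is, up to conjugation,
  the Fourier transform at \<open>m\<close> of the piece of the transform of \<open>e n\<close> on \<open>[0, 1]\<close>. It tends to \<open>0\<close>
  as \<open>m\<close> grows, by the Riemann-Lebesgue lemma,
  and its square is at most a constant times \<open>(1 + |b n|)\<^sup>-\<^sup>q\<close> for all \<open>m\<close>, by the bound on the
  \<open>q\<close>-dispersion. Dominated convergence for series makes the sum of the squared coefficients tend
  to \<open>0\<close>, whereas it should stay above the lower frame bound.

  Plancherel's theorem for integrable square-integrable functions is derived here from the Fourier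
  transform of the Gaussian and from the continuity of translations in \<open>L\<^sup>1\<close>; the latter also yields
  the Riemann-Lebesgue lemma.
\<close>

section \<open>Continuity of translations in the mean\<close>

lemma integrable_shift:
  fixes g :: "real \<Rightarrow> 'a :: {banach, second_countable_topology}"
  assumes "integrable lborel g"
  shows "integrable lborel (\<lambda>t. g (t + y))"
  using lborel_integrable_real_affine[OF assms, of 1 y] by (simp add: add.commute)

lemma integral_shift:
  fixes g :: "real \<Rightarrow> 'a :: {banach, second_countable_topology}"
  shows "(LINT t|lborel. g (t + y)) = (LINT t|lborel. g t)"
  using lborel_integral_real_affine[of 1 g y] by (simp add: add.commute)

text \<open>Openness makes \<open>U \<inter> (U - y)\<close> fill up \<open>U\<close> pointwise as \<open>y\<close> tends to \<open>0\<close>, hence in measure, and the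
  symmetric difference of two sets of equal measure is controlled by their intersection.\<close>
lemma translation_indicator_open:
  fixes U :: "real set"
  assumes "open U" and fin: "emeasure lborel U < \<infinity>" and y: "y \<longlonglongrightarrow> (0::real)"
  shows "(\<lambda>n. LINT t|lborel. \<bar>indicat_real U (t + y n) - indicat_real U t\<bar>) \<longlonglongrightarrow> 0"
proof -
  have [measurable]: "U \<in> sets borel" using \<open>open U\<close> by simp
  have intU: "integrable lborel (indicat_real U)" using fin by (simp add: integrable_indicator_iff)
  have lim: "(\<lambda>n. LINT t|lborel. indicat_real U (t + y n) * indicat_real U t) \<longlonglongrightarrow> (LINT t|lborel. indicat_real U t)"
  proof (rule integral_dominated_convergence[where w="indicat_real U"])
    show "AE t in lborel. (\<lambda>n. indicat_real U (t + y n) * indicat_real U t) \<longlonglongrightarrow> indicat_real U t"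
    proof (rule AE_I2)
      fix t
      show "(\<lambda>n. indicat_real U (t + y n) * indicat_real U t) \<longlonglongrightarrow> indicat_real U t"
      proof (cases "t \<in> U")
        case True
        have "(\<lambda>n. t + y n) \<longlonglongrightarrow> t" using tendsto_add[OF tendsto_const y, of t] by simp
        then have "\<forall>\<^sub>F n in sequentially. t + y n \<in> U" using \<open>open U\<close> True by (rule topological_tendstoD)
        then have "\<forall>\<^sub>F n in sequentially. indicat_real U (t + y n) * indicat_real U t = indicat_real U t"
          by eventually_elim (simp add: True)
        then show ?thesis by (simp add: tendsto_eventually)
      qed simp
    qed
  qed (use intU in \<open>auto split: split_indicator\<close>)
  have int1: "integrable lborel (\<lambda>t. indicat_real U (t + y n))" for n
    by (rule integrable_shift[OF intU])
  have int2: "integrable lborel (\<lambda>t. indicat_real U (t + y n) * indicat_real U t)" for n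
    by (rule Bochner_Integration.integrable_bound[OF intU]) (auto split: split_indicator)
  have "(LINT t|lborel. \<bar>indicat_real U (t + y n) - indicat_real U t\<bar>)
      = 2 * (LINT t|lborel. indicat_real U t) - 2 * (LINT t|lborel. indicat_real U (t + y n) * indicat_real U t)" for n
  proof -
    have "(LINT t|lborel. \<bar>indicat_real U (t + y n) - indicat_real U t\<bar>)
      = (LINT t|lborel. indicat_real U (t + y n) + indicat_real U t - 2 * (indicat_real U (t + y n) * indicat_real U t))"
      by (rule Bochner_Integration.integral_cong) (auto split: split_indicator)
    also have "\<dots> = (LINT t|lborel. indicat_real U (t + y n)) + (LINT t|lborel. indicat_real U t) - 2 * (LINT t|lborel. indicat_real U (t + y n) * indicat_real U t)"
      using int1 int2 intU by simp
    finally show ?thesis by (simp add: integral_shift[of "indicat_real U"])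
  qed
  moreover have "(\<lambda>n. 2 * (LINT t|lborel. indicat_real U t) - 2 * (LINT t|lborel. indicat_real U (t + y n) * indicat_real U t))
     \<longlonglongrightarrow> 2 * (LINT t|lborel. indicat_real U t) - 2 * (LINT t|lborel. indicat_real U t)"
    by (intro tendsto_intros lim)
  ultimately show ?thesis by simp
qed

lemma translation_approx:
  fixes g h :: "real \<Rightarrow> 'a :: {banach, second_countable_topology}"
  assumes "integrable lborel g" and "integrable lborel h"
  shows "(LINT t|lborel. norm (g (t + y) - g t)) \<le>
     2 * (LINT t|lborel. norm (g t - h t)) + (LINT t|lborel. norm (h (t + y) - h t))"
proof -
  note [simp] = assms integrable_shift[OF assms(1)] integrable_shift[OF assms(2)]
  have "integrable lborel (\<lambda>t. norm (g t - h t))" by simp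
  note [simp] = integrable_shift[OF this, of y]
  have "(LINT t|lborel. norm (g (t + y) - g t)) \<le> 
     (LINT t|lborel. norm (g (t + y) - h (t + y)) + norm (g t - h t) + norm (h (t + y) - h t))"
  proof (rule integral_mono)
    fix t
    have "norm ((g (t + y) - h (t + y)) - (g t - h t) + (h (t + y) - h t))
        \<le> norm (g (t + y) - h (t + y)) + norm (g t - h t) + norm (h (t + y) - h t)"
      by (rule order_trans[OF norm_triangle_ineq add_right_mono[OF norm_triangle_ineq4]])
    then show "norm (g (t + y) - g t) \<le> norm (g (t + y) - h (t + y)) + norm (g t - h t) + norm (h (t + y) - h t)"
      by simp
  qed simp_all
  also have "\<dots> = (LINT t|lborel. norm (g (t + y) - h (t + y))) + (LINT t|lborel. norm (g t - h t)) + (LINT t|lborel. norm (h (t + y) - h t))"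
    by simp
  also have "(LINT t|lborel. norm (g (t + y) - h (t + y))) = (LINT t|lborel. norm (g t - h t))"
    by (rule integral_shift)
  finally show ?thesis by simp
qed

text \<open>Translations are isometries, so the functions on which they act continuously form a closed subset
  of \<open>L\<^sup>1\<close>.\<close>
lemma translation_closed:
  fixes g :: "real \<Rightarrow> 'a :: {banach, second_countable_topology}"
  assumes g: "integrable lborel g"
    and approx: "\<And>\<epsilon>. 0 < \<epsilon> \<Longrightarrow> \<exists>h. integrable lborel h \<and> (LINT t|lborel. norm (g t - h t)) < \<epsilon> \<and>
      (\<lambda>n. LINT t|lborel. norm (h (t + y n) - h t)) \<longlonglongrightarrow> 0"
  shows "(\<lambda>n. LINT t|lborel. norm (g (t + y n) - g t)) \<longlonglongrightarrow> 0"
proof (rule LIMSEQ_I)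
  fix r :: real assume "0 < r"
  then obtain h where h: "integrable lborel h" "(LINT t|lborel. norm (g t - h t)) < r / 4"
      "(\<lambda>n. LINT t|lborel. norm (h (t + y n) - h t)) \<longlonglongrightarrow> 0"
    using approx[of "r/4"] by auto
  obtain N where N: "\<And>n. n \<ge> N \<Longrightarrow> norm ((LINT t|lborel. norm (h (t + y n) - h t)) - 0) < r / 2"
    using LIMSEQ_D[OF h(3), of "r/2"] \<open>0 < r\<close> by auto
  have "norm ((LINT t|lborel. norm (g (t + y n) - g t)) - 0) < r" if "n \<ge> N" for n
  proof -
    have "(LINT t|lborel. norm (g (t + y n) - g t)) \<ge> 0" by simp
    then show ?thesis using translation_approx[OF g h(1), of "y n"] h(2) N[OF that] by simp
  qed
  then show "\<exists>no. \<forall>n\<ge>no. norm ((LINT t|lborel. norm (g (t + y n) - g t)) - 0) < r" by blast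
qed

text \<open>By approximation: open sets approximate Borel sets of finite measure from outside, the
  indicators of such Borel sets span the simple functions, and these are dense.\<close>
lemma translation_L1_continuous:
  fixes g :: "real \<Rightarrow> 'a :: {banach, second_countable_topology}"
  assumes "integrable lborel g" and y: "y \<longlonglongrightarrow> (0::real)"
  shows "(\<lambda>n. LINT t|lborel. norm (g (t + y n) - g t)) \<longlonglongrightarrow> 0"
  using assms(1)
proof (induct rule: integrable_induct)
  case (base A c)
  have [measurable]: "A \<in> sets borel" using base(1) by simp
  have intA: "integrable lborel (indicat_real A)" using base by (simp add: integrable_indicator_iff)
  have *: "(\<lambda>n. LINT t|lborel. norm (indicat_real A (t + y n) - indicat_real A t)) \<longlonglongrightarrow> 0"
  proof (rule translation_closed[OF intA])
    fix \<epsilon> :: real assume "0 < \<epsilon>"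
    then obtain U where U: "open U" "A \<subseteq> U" "emeasure lborel (U - A) < \<epsilon>"
      using outer_regular_lborel[of A \<epsilon>] by auto
    have [measurable]: "U \<in> sets borel" using U by simp
    have "emeasure lborel U \<le> emeasure lborel A + emeasure lborel (U - A)"
      by (rule order_trans[OF _ emeasure_subadditive]) (auto intro!: emeasure_mono)
    also have "\<dots> < \<infinity>" using base(2) order_less_trans[OF U(3) ennreal_less_top] by simp
    finally have finU: "emeasure lborel U < \<infinity>" .
    have "(LINT t|lborel. norm (indicat_real A t - indicat_real U t)) = (LINT t|lborel. indicat_real (U - A) t)"
      using U(2) by (intro Bochner_Integration.integral_cong) (auto split: split_indicator)
    also have "\<dots> = measure lborel (U - A)" by simp
    also have "\<dots> < \<epsilon>" using U(3) \<open>0 < \<epsilon>\<close> unfolding measure_def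
      by (metis enn2real_less_iff ennreal_less_top order_less_trans less_top)
    finally show "\<exists>h. integrable lborel h \<and> (LINT t|lborel. norm (indicat_real A t - h t)) < \<epsilon> \<and>
      (\<lambda>n. LINT t|lborel. norm (h (t + y n) - h t)) \<longlonglongrightarrow> 0"
      using translation_indicator_open[OF U(1) finU y] finU
      by (intro exI[of _ "indicat_real U"]) (simp add: integrable_indicator_iff)
  qed
  have "(\<lambda>n. (LINT t|lborel. norm (indicat_real A (t + y n) - indicat_real A t)) * norm c) \<longlonglongrightarrow> 0"
    using tendsto_mult_left_zero[OF *] .
  then show ?case by (simp add: scaleR_diff_left[symmetric])
next
  case (add f g)
  note int = add(1,3) integrable_shift[OF add(1)] integrable_shift[OF add(3)]
  have "(\<lambda>n. (LINT t|lborel. norm (f (t + y n) - f t)) + (LINT t|lborel. norm (g (t + y n) - g t))) \<longlonglongrightarrow> 0"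
    using tendsto_add[OF add(2,4)] by simp
  then show ?case
  proof (rule Lim_null_comparison[rotated], intro always_eventually allI)
    fix n
    have "(LINT t|lborel. norm ((f (t + y n) + g (t + y n)) - (f t + g t)))
      \<le> (LINT t|lborel. norm (f (t + y n) - f t) + norm (g (t + y n) - g t))"
      by (intro integral_mono) (use int in \<open>auto simp: add_diff_add intro: norm_triangle_ineq\<close>)
    also have "\<dots> = (LINT t|lborel. norm (f (t + y n) - f t)) + (LINT t|lborel. norm (g (t + y n) - g t))"
      using int by simp
    finally show "norm (LINT t|lborel. norm ((f (t + y n) + g (t + y n)) - (f t + g t))) \<le>
      (LINT t|lborel. norm (f (t + y n) - f t)) + (LINT t|lborel. norm (g (t + y n) - g t))" by simp
  qed
next
  case (lim f s)
  show ?case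
  proof (rule translation_closed[OF lim(5)])
    fix \<epsilon> :: real assume "0 < \<epsilon>"
    have "(\<lambda>i. LINT t|lborel. norm (f t - s i t)) \<longlonglongrightarrow> (LINT t|(lborel::real measure). 0)"
    proof (rule integral_dominated_convergence[where w="\<lambda>t. 3 * norm (f t)"])
      show "AE t in lborel. (\<lambda>i. norm (f t - s i t)) \<longlonglongrightarrow> 0"
        using lim(3) by (auto intro!: AE_I2 tendsto_eq_intros)
      show "AE t in lborel. norm (norm (f t - s i t)) \<le> 3 * norm (f t)" for i
        using lim(4)[of _ i] by (auto intro!: AE_I2 norm_triangle_le_diff)
    qed (use lim(1,5) in \<open>auto\<close>)
    then have "\<forall>\<^sub>F i in sequentially. (LINT t|lborel. norm (f t - s i t)) < \<epsilon>"
      using \<open>0 < \<epsilon>\<close> by (auto dest!: order_tendstoD(2))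
    then obtain i where "(LINT t|lborel. norm (f t - s i t)) < \<epsilon>"
      by (meson eventually_sequentially order_refl)
    then show "\<exists>h. integrable lborel h \<and> (LINT t|lborel. norm (f t - h t)) < \<epsilon> \<and>
      (\<lambda>n. LINT t|lborel. norm (h (t + y n) - h t)) \<longlonglongrightarrow> 0"
      using lim(1,2) by (intro exI[of _ "s i"]) auto
  qed
qed

section \<open>Fourier integrals and Plancherel's theorem\<close>

text \<open>The map \<open>a \<mapsto> \<bar>a\<bar> a\<close> sends \<open>L\<^sup>2\<close> to \<open>L\<^sup>1\<close>. This bound on its inverse transfers the continuity of
  translations from \<open>L\<^sup>1\<close> to \<open>L\<^sup>2\<close>. With \<open>r\<close>, \<open>s\<close> the norms and \<open>d = r s - a \<bullet> b\<close>, which lies between \<open>0\<close> and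
  \<open>2 r s\<close> by Cauchy-Schwarz, the squared inequality is a polynomial one in \<open>r\<close>, \<open>s\<close>, \<open>d\<close>.\<close>
lemma norm_diff_sq_le_scaled:
  fixes a b :: "'a :: real_inner"
  shows "(norm (a - b))\<^sup>2 \<le> 2 * norm (norm a *\<^sub>R a - norm b *\<^sub>R b)"
proof -
  define r s d where "r = norm a" and "s = norm b" and "d = r * s - a \<bullet> b"
  have rs: "0 \<le> r" "0 \<le> s" by (auto simp: r_def s_def)
  have d: "0 \<le> d" "d \<le> 2 * (r * s)"
    using Cauchy_Schwarz_ineq2[of a b] by (auto simp: d_def r_def s_def abs_le_iff)
  have aa: "a \<bullet> a = r\<^sup>2" "b \<bullet> b = s\<^sup>2" "a \<bullet> b = r * s - d" "b \<bullet> a = r * s - d"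
    by (auto simp: r_def s_def d_def power2_norm_eq_inner inner_commute)
  have X: "(norm (a - b))\<^sup>2 = (r - s)\<^sup>2 + 2 * d"
    unfolding power2_norm_eq_inner by (simp add: inner_diff aa power2_eq_square algebra_simps)
  have Y: "(norm (norm a *\<^sub>R a - norm b *\<^sub>R b))\<^sup>2 = (r\<^sup>2 - s\<^sup>2)\<^sup>2 + 2 * (r * s) * d"
    unfolding power2_norm_eq_inner r_def[symmetric] s_def[symmetric]
    by (simp add: inner_diff aa power2_eq_square algebra_simps)
  have "4 * ((r\<^sup>2 - s\<^sup>2)\<^sup>2 + 2 * (r * s) * d) - ((r - s)\<^sup>2 + 2 * d)\<^sup>2
      = 4 * d * (2 * (r * s) - d) + (r - s)\<^sup>2 * (4 * (2 * (r * s) - d) + 4 * r\<^sup>2 + 4 * s\<^sup>2 - (r - s)\<^sup>2)"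
    by (simp add: power2_eq_square algebra_simps)
  moreover have "0 \<le> 4 * r\<^sup>2 + 4 * s\<^sup>2 - (r - s)\<^sup>2"
    using mult_nonneg_nonneg[OF rs] zero_le_power2[of r] zero_le_power2[of s] unfolding power2_diff by linarith
  ultimately have "0 \<le> 4 * ((r\<^sup>2 - s\<^sup>2)\<^sup>2 + 2 * (r * s) * d) - ((r - s)\<^sup>2 + 2 * d)\<^sup>2"
    using d by (smt (verit, best) mult_nonneg_nonneg zero_le_power2)
  then have "((norm (a - b))\<^sup>2)\<^sup>2 \<le> (2 * norm (norm a *\<^sub>R a - norm b *\<^sub>R b))\<^sup>2"
    by (simp only: X Y power_mult_distrib) simp
  then show ?thesis by (rule power2_le_imp_le) simp
qed

definition phase :: "real \<Rightarrow> complex" where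
  "phase s = exp (- (2 * complex_of_real pi * \<i> * complex_of_real s))"

definition fourier :: "(real \<Rightarrow> complex) \<Rightarrow> real \<Rightarrow> complex" where
  "fourier g \<xi> = (LINT t|lborel. g t * phase (t * \<xi>))"

lemma norm_phase [simp]: "cmod (phase s) = 1"
  by (simp add: phase_def norm_exp_eq_Re)

lemma phase_add: "phase (s + t) = phase s * phase t"
  by (simp add: phase_def exp_add[symmetric] algebra_simps)

lemma cnj_phase: "cnj (phase s) = phase (- s)"
  by (simp add: phase_def exp_cnj)

lemma phase_0 [simp]: "phase 0 = 1"
  by (simp add: phase_def)

lemma phase_measurable [measurable]: "phase \<in> borel_measurable borel"
  unfolding phase_def by (intro borel_measurable_continuous_onI continuous_intros)

lemma integrable_mult_bounded:
  fixes u k :: "'a \<Rightarrow> complex"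
  assumes "integrable M u" and [measurable]: "k \<in> borel_measurable M" and "\<And>x. cmod (k x) \<le> C"
  shows "integrable M (\<lambda>x. u x * k x)"
proof (rule Bochner_Integration.integrable_bound)
  show "integrable M (\<lambda>x. C * cmod (u x))" using assms by simp
  show "AE x in M. cmod (u x * k x) \<le> norm (C * cmod (u x))"
    using order_trans[OF assms(3) abs_ge_self]
    by (auto intro!: AE_I2 mult_left_mono simp: norm_mult mult.commute[of C] abs_mult)
qed (use assms in measurable)

lemma norm_fourier_le: "cmod (fourier g \<xi>) \<le> (LINT t|lborel. cmod (g t))"
  unfolding fourier_def
  by (rule order_trans[OF integral_norm_bound]) (simp add: norm_mult)

lemma fourier_measurable [measurable]:
  assumes [measurable]: "g \<in> borel_measurable borel"
  shows "fourier g \<in> borel_measurable borel"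
  unfolding fourier_def by measurable

lemma integrable_product_kernel:
  fixes u v :: "real \<Rightarrow> complex"
  assumes u: "integrable lborel u" and v: "integrable lborel v"
    and [measurable]: "k \<in> borel_measurable (borel \<Otimes>\<^sub>M borel)" and k: "\<And>z. cmod (k z) \<le> 1"
  shows "integrable (lborel \<Otimes>\<^sub>M lborel) (\<lambda>(t, x). u t * (k (t, x) * v x))"
proof -
  have [measurable]: "u \<in> borel_measurable borel" "v \<in> borel_measurable borel" using u v by auto
  have *: "integrable (lborel \<Otimes>\<^sub>M lborel) (\<lambda>(t, x). u t * v x)"
  proof (rule lborel_pair.Fubini_integrable)
    show "integrable lborel (\<lambda>t. LINT x|lborel. norm (case (t, x) of (t, x) \<Rightarrow> u t * v x))"
      using u v by (simp add: norm_mult)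
  qed (use u v in auto)
  show ?thesis
  proof (rule Bochner_Integration.integrable_bound[OF *])
    have "cmod (u t * (k (t, x) * v x)) \<le> cmod (u t * v x)" for t x
      unfolding norm_mult by (intro mult_left_mono mult_left_le_one_le k) auto
    then show "AE z in lborel \<Otimes>\<^sub>M lborel. cmod (case z of (t, x) \<Rightarrow> u t * (k (t, x) * v x))
        \<le> cmod (case z of (t, x) \<Rightarrow> u t * v x)"
      by (intro AE_I2) auto
  qed measurable
qed

text \<open>Fubini's theorem. This symmetry is what moves the Fourier transform onto an explicitly known factor.\<close>
lemma fourier_multiplication:
  assumes u: "integrable lborel u" and v: "integrable lborel v"
  shows "(LINT \<xi>|lborel. fourier u \<xi> * v \<xi>) = (LINT t|lborel. u t * fourier v t)"
proof -
  have "integrable (lborel \<Otimes>\<^sub>M lborel) (\<lambda>(t, x). u t * ((\<lambda>(t,x). phase (t * x)) (t, x) * v x))"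
    by (rule integrable_product_kernel[OF u v]) auto
  then have int: "integrable (lborel \<Otimes>\<^sub>M lborel) (\<lambda>(t, x). u t * phase (t * x) * v x)"
    by (simp add: mult.assoc)
  have "(LINT \<xi>|lborel. fourier u \<xi> * v \<xi>) = (LINT \<xi>|lborel. LINT t|lborel. u t * phase (t * \<xi>) * v \<xi>)"
    by (simp add: fourier_def)
  also have "\<dots> = (LINT t|lborel. LINT \<xi>|lborel. u t * phase (t * \<xi>) * v \<xi>)"
    by (rule lborel_pair.Fubini_integral[OF int])
  also have "\<dots> = (LINT t|lborel. u t * fourier v t)"
    by (simp add: fourier_def mult_ac)
  finally show ?thesis .
qed

text \<open>The characteristic function of the standard normal law, rescaled.\<close>
lemma fourier_gaussian:
  assumes "0 < c"
  shows "fourier (\<lambda>x. complex_of_real (exp (- (x / c)\<^sup>2 / 2))) y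
    = complex_of_real (c * sqrt (2 * pi) * exp (- (2 * pi * c * y)\<^sup>2 / 2))"
proof -
  have "complex_of_real (exp (- (2 * pi * c * y)\<^sup>2 / 2)) = char std_normal_distribution (- (2 * pi * c * y))"
    by (simp add: char_std_normal_distribution)
  also have "\<dots> = (LINT x|lborel. complex_of_real (std_normal_density x) * phase (c * x * y))"
    unfolding char_def
    by (subst integral_density) (auto simp: scaleR_conv_of_real phase_def mult_ac)
  also have "\<dots> = (LINT x|lborel. complex_of_real (1 / sqrt (2 * pi)) * (complex_of_real (exp (- x\<^sup>2 / 2)) * phase (c * x * y)))"
    by (simp add: std_normal_density_def mult_ac)
  also have "\<dots> = complex_of_real (1 / sqrt (2 * pi)) * (LINT x|lborel. complex_of_real (exp (- x\<^sup>2 / 2)) * phase (c * x * y))"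
    by (rule integral_mult_right_zero)
  finally have *: "complex_of_real (1 / sqrt (2 * pi)) * (LINT x|lborel. complex_of_real (exp (- x\<^sup>2 / 2)) * phase (c * x * y))
      = complex_of_real (exp (- (2 * pi * c * y)\<^sup>2 / 2))" by (rule sym)
  have "(LINT x|lborel. complex_of_real (exp (- x\<^sup>2 / 2)) * phase (c * x * y))
      = complex_of_real (sqrt (2 * pi)) * (complex_of_real (1 / sqrt (2 * pi)) * (LINT x|lborel. complex_of_real (exp (- x\<^sup>2 / 2)) * phase (c * x * y)))"
    by (simp add: mult.assoc[symmetric] of_real_mult[symmetric] del: of_real_mult)
  note * = this[unfolded *]
  have "fourier (\<lambda>x. complex_of_real (exp (- (x / c)\<^sup>2 / 2))) y
     = c *\<^sub>R (LINT x|lborel. complex_of_real (exp (- x\<^sup>2 / 2)) * phase (c * x * y))"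
    unfolding fourier_def
    by (subst lborel_integral_real_affine[where c = c and t = 0]) (use assms in auto)
  then show ?thesis by (simp only: *) (simp add: scaleR_conv_of_real)
qed

lemma integrable_gaussian:
  assumes "0 < c"
  shows "integrable lborel (\<lambda>x. complex_of_real (exp (- (x / c)\<^sup>2 / 2)))"
proof -
  have "integrable lborel (\<lambda>x. sqrt (2 * pi) * std_normal_density x)"
    using integrable_std_normal_moment[of 0] by simp
  then have "integrable lborel (\<lambda>x::real. exp (- x\<^sup>2 / 2))"
    by (simp add: std_normal_density_def del: power_divide)
  then have "integrable lborel (\<lambda>x. exp (- (x / c)\<^sup>2 / 2))"
    using lborel_integrable_real_affine[of "\<lambda>x. exp (- x\<^sup>2 / 2)" "1/c" 0] assms by simp
  then show ?thesis by simp
qed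

text \<open>The inverse Fourier transform of the power spectrum of \<open>g\<close>; its value at \<open>0\<close> is the energy of \<open>g\<close>.\<close>
definition autocorrelation :: "(real \<Rightarrow> complex) \<Rightarrow> real \<Rightarrow> complex" where
  "autocorrelation g y = (LINT t|lborel. g (t + y) * cnj (g t))"

lemma cnj_measurable [measurable]:
  "f \<in> borel_measurable M \<Longrightarrow> (\<lambda>x. cnj (f x)) \<in> borel_measurable M"
  by (rule measurable_compose[where g=cnj]) (auto intro!: borel_measurable_continuous_onI continuous_intros)

lemma integrable_mult_cnj:
  fixes f g :: "'a \<Rightarrow> complex"
  assumes [measurable]: "f \<in> borel_measurable M" "g \<in> borel_measurable M"
    and f: "integrable M (\<lambda>t. (cmod (f t))\<^sup>2)" and g: "integrable M (\<lambda>t. (cmod (g t))\<^sup>2)"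
  shows "integrable M (\<lambda>t. f t * cnj (g t))"
proof (rule Bochner_Integration.integrable_bound)
  show "integrable M (\<lambda>t. (cmod (f t))\<^sup>2 + (cmod (g t))\<^sup>2)" using f g by simp
  have "a * b \<le> a\<^sup>2 + b\<^sup>2" if "0 \<le> a" "0 \<le> b" for a b :: real
    using sum_squares_bound[of a b] mult_nonneg_nonneg[OF that] by linarith
  then show "AE t in M. norm (f t * cnj (g t)) \<le> norm ((cmod (f t))\<^sup>2 + (cmod (g t))\<^sup>2)"
    by (intro AE_I2) (simp add: norm_mult)
qed measurable

lemma Re_autocorrelation:
  assumes [measurable]: "g \<in> borel_measurable borel" and g2: "integrable lborel (\<lambda>t. (cmod (g t))\<^sup>2)"
  shows "Re (autocorrelation g y) = (LINT t|lborel. (cmod (g t))\<^sup>2) - (LINT t|lborel. (cmod (g (t + y) - g t))\<^sup>2) / 2"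
    and "integrable lborel (\<lambda>t. (cmod (g (t + y) - g t))\<^sup>2)"
proof -
  have s2: "integrable lborel (\<lambda>t. (cmod (g (t + y)))\<^sup>2)" by (rule integrable_shift[OF g2])
  have int: "integrable lborel (\<lambda>t. g (t + y) * cnj (g t))"
    by (rule integrable_mult_cnj) (use g2 s2 in auto)
  have eq: "(cmod (g (t + y) - g t))\<^sup>2 = (cmod (g (t + y)))\<^sup>2 + (cmod (g t))\<^sup>2 - 2 * Re (g (t + y) * cnj (g t))" for t
    unfolding cmod_power2 by (simp add: power2_eq_square algebra_simps)
  show "integrable lborel (\<lambda>t. (cmod (g (t + y) - g t))\<^sup>2)"
    unfolding eq by (intro Bochner_Integration.integrable_diff Bochner_Integration.integrable_add integrable_mult_right integrable_Re int s2 g2)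
  have "(LINT t|lborel. (cmod (g (t + y) - g t))\<^sup>2)
     = (LINT t|lborel. (cmod (g (t + y)))\<^sup>2) + (LINT t|lborel. (cmod (g t))\<^sup>2) - 2 * Re (autocorrelation g y)"
    unfolding eq autocorrelation_def integral_Re[OF int, symmetric]
    by (subst Bochner_Integration.integral_diff Bochner_Integration.integral_add integral_mult_right_zero,
        (intro Bochner_Integration.integrable_add integrable_mult_right integrable_Re int s2 g2)+)+
      (simp only: integral_mult_right_zero)
  then show "Re (autocorrelation g y) = (LINT t|lborel. (cmod (g t))\<^sup>2) - (LINT t|lborel. (cmod (g (t + y) - g t))\<^sup>2) / 2"
    using integral_shift[of "\<lambda>t. (cmod (g t))\<^sup>2" y] by (simp add: diff_divide_distrib)
qed

text \<open>The defect from the value at \<open>0\<close> is half the squared \<open>L\<^sup>2\<close> distance of \<open>g\<close> from its translate.\<close>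
lemma Re_autocorrelation_tendsto:
  assumes [measurable]: "g \<in> borel_measurable borel" and g2: "integrable lborel (\<lambda>t. (cmod (g t))\<^sup>2)"
    and y: "y \<longlonglongrightarrow> 0"
  shows "(\<lambda>n. Re (autocorrelation g (y n))) \<longlonglongrightarrow> (LINT t|lborel. (cmod (g t))\<^sup>2)"
proof -
  define G where "G t = norm (g t) *\<^sub>R g t" for t
  have G: "integrable lborel G"
    by (rule Bochner_Integration.integrable_bound[OF g2]) (auto simp: G_def[abs_def] power2_eq_square)
  have "(\<lambda>n. LINT t|lborel. (cmod (g (t + y n) - g t))\<^sup>2) \<longlonglongrightarrow> 0"
  proof (rule Lim_null_comparison)
    show "(\<lambda>n. 2 * (LINT t|lborel. norm (G (t + y n) - G t))) \<longlonglongrightarrow> 0"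
      using tendsto_mult_right_zero[OF translation_L1_continuous[OF G y]] .
    have "(LINT t|lborel. (cmod (g (t + y n) - g t))\<^sup>2) \<le> (LINT t|lborel. 2 * norm (G (t + y n) - G t))" for n
    proof (rule integral_mono)
      show "integrable lborel (\<lambda>t. 2 * norm (G (t + y n) - G t))"
        by (intro integrable_mult_right integrable_norm Bochner_Integration.integrable_diff G integrable_shift[OF G])
    qed (use Re_autocorrelation(2)[OF assms(1) g2] norm_diff_sq_le_scaled in \<open>auto simp: G_def\<close>)
    then show "\<forall>\<^sub>F n in sequentially. norm (LINT t|lborel. (cmod (g (t + y n) - g t))\<^sup>2) \<le> 2 * (LINT t|lborel. norm (G (t + y n) - G t))"
      by simp
  qed
  from tendsto_diff[OF tendsto_const tendsto_divide[OF this tendsto_const[of 2]]]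
  show ?thesis unfolding Re_autocorrelation(1)[OF assms(1) g2] by simp
qed

lemma Re_autocorrelation_bound:
  assumes [measurable]: "g \<in> borel_measurable borel" and g2: "integrable lborel (\<lambda>t. (cmod (g t))\<^sup>2)"
  shows "\<bar>Re (autocorrelation g y)\<bar> \<le> (LINT t|lborel. (cmod (g t))\<^sup>2)"
proof -
  have s2: "integrable lborel (\<lambda>t. (cmod (g (t + y)))\<^sup>2)" by (rule integrable_shift[OF g2])
  have int: "integrable lborel (\<lambda>t. g (t + y) * cnj (g t))"
    by (rule integrable_mult_cnj) (use g2 s2 in auto)
  have "\<bar>Re (autocorrelation g y)\<bar> \<le> cmod (autocorrelation g y)" by (rule abs_Re_le_cmod)
  also have "\<dots> \<le> (LINT t|lborel. cmod (g (t + y) * cnj (g t)))"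
    unfolding autocorrelation_def by (rule integral_norm_bound)
  also have "\<dots> \<le> (LINT t|lborel. ((cmod (g (t + y)))\<^sup>2 + (cmod (g t))\<^sup>2) / 2)"
  proof (rule integral_mono)
    show "cmod (g (t + y) * cnj (g t)) \<le> ((cmod (g (t + y)))\<^sup>2 + (cmod (g t))\<^sup>2) / 2" for t
      using sum_squares_bound[of "cmod (g (t + y))" "cmod (g t)"] by (simp add: norm_mult)
  qed (use int s2 g2 in \<open>auto intro: integrable_norm\<close>)
  also have "\<dots> = (LINT t|lborel. (cmod (g t))\<^sup>2)"
    using s2 g2 integral_shift[of "\<lambda>t. (cmod (g t))\<^sup>2" y] by simp
  finally show ?thesis .
qed

lemma autocorrelation_integrable_pair:
  assumes g: "integrable lborel g"
  shows "integrable (lborel \<Otimes>\<^sub>M lborel) (\<lambda>(t, y). g (t + y) * cnj (g t) * phase (y * \<xi>))"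
proof (rule lborel_pair.Fubini_integrable)
  have [measurable]: "g \<in> borel_measurable borel" using g by auto
  show "(\<lambda>(t, y). g (t + y) * cnj (g t) * phase (y * \<xi>)) \<in> borel_measurable (lborel \<Otimes>\<^sub>M lborel)"
    by measurable
  have sh: "integrable lborel (\<lambda>y. g (t + y))" for t
    using integrable_shift[OF g, of t] by (simp add: add.commute)
  have "(LINT y|lborel. norm (g (t + y))) = (LINT y|lborel. norm (g y))" for t
    using integral_shift[of "\<lambda>y. norm (g y)" t] by (simp add: add.commute)
  then show "integrable lborel (\<lambda>t. LINT y|lborel. norm (case (t, y) of (t, y) \<Rightarrow> g (t + y) * cnj (g t) * phase (y * \<xi>)))"
    using g by (simp add: norm_mult)
  show "AE t in lborel. integrable lborel (\<lambda>y. case (t, y) of (t, y) \<Rightarrow> g (t + y) * cnj (g t) * phase (y * \<xi>))"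
    using integrable_mult_bounded[OF integrable_mult_left[OF sh], of _ 1] by (auto intro!: AE_I2)
qed

lemma autocorrelation_integrable:
  assumes g: "integrable lborel g"
  shows "integrable lborel (autocorrelation g)"
  using lborel_pair.integrable_snd[OF autocorrelation_integrable_pair[OF g, of 0]]
  by (simp add: autocorrelation_def[abs_def])

text \<open>Writing the phase at \<open>y\<close> as the phase at \<open>t + y\<close> times the conjugate phase at \<open>t\<close> separates
  the double integral into the transform of \<open>g\<close> and its conjugate.\<close>
lemma fourier_autocorrelation:
  assumes g: "integrable lborel g"
  shows "fourier (autocorrelation g) \<xi> = complex_of_real ((cmod (fourier g \<xi>))\<^sup>2)"
proof -
  have inner: "(LINT y|lborel. g (t + y) * cnj (g t) * phase (y * \<xi>)) = cnj (g t) * cnj (phase (t * \<xi>)) * fourier g \<xi>" for t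
  proof -
    have "g (t + y) * cnj (g t) * phase (y * \<xi>) = cnj (g t) * cnj (phase (t * \<xi>)) * (g (y + t) * phase ((y + t) * \<xi>))" for y
    proof -
      have "phase ((y + t) * \<xi>) * cnj (phase (t * \<xi>)) = phase (y * \<xi>)"
        by (simp add: cnj_phase phase_add[symmetric] algebra_simps)
      then show ?thesis by (simp add: mult_ac add.commute)
    qed
    then have "(LINT y|lborel. g (t + y) * cnj (g t) * phase (y * \<xi>))
       = cnj (g t) * cnj (phase (t * \<xi>)) * (LINT y|lborel. (\<lambda>y. g y * phase (y * \<xi>)) (y + t))"
      by (simp only: integral_mult_right_zero)
    also have "(LINT y|lborel. (\<lambda>y. g y * phase (y * \<xi>)) (y + t)) = fourier g \<xi>"
      unfolding fourier_def by (rule integral_shift)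
    finally show ?thesis .
  qed
  have "fourier (autocorrelation g) \<xi> = (LINT y|lborel. LINT t|lborel. g (t + y) * cnj (g t) * phase (y * \<xi>))"
    by (simp add: fourier_def autocorrelation_def)
  also have "\<dots> = (LINT t|lborel. LINT y|lborel. g (t + y) * cnj (g t) * phase (y * \<xi>))"
    by (rule lborel_pair.Fubini_integral[OF autocorrelation_integrable_pair[OF g]])
  also have "\<dots> = (LINT t|lborel. cnj (g t * phase (t * \<xi>)) * fourier g \<xi>)"
    by (simp add: inner)
  also have "\<dots> = cnj (fourier g \<xi>) * fourier g \<xi>"
    by (simp only: integral_mult_left_zero fourier_def Bochner_Integration.integral_cnj)
  also have "\<dots> = complex_of_real ((cmod (fourier g \<xi>))\<^sup>2)"
    by (simp add: complex_norm_square mult.commute del: of_real_power)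
  finally show ?thesis .
qed

text \<open>A Gaussian weight of width \<open>c\<close> on the frequency side corresponds to a Gaussian average of width
  proportional to \<open>1 / c\<close> of the autocorrelation; the average is rescaled to the standard normal law.\<close>
lemma gaussian_mean_fourier_sq:
  assumes g: "integrable lborel g" and c: "0 < c"
  shows "(LINT \<xi>|lborel. (cmod (fourier g \<xi>))\<^sup>2 * exp (- (\<xi> / c)\<^sup>2 / 2))
     = (LINT z|lborel. Re (autocorrelation g (z / (2 * pi * c))) * std_normal_density z)"
proof -
  note a = autocorrelation_integrable[OF g]
  have "complex_of_real (LINT \<xi>|lborel. (cmod (fourier g \<xi>))\<^sup>2 * exp (- (\<xi> / c)\<^sup>2 / 2))
    = (LINT \<xi>|lborel. fourier (autocorrelation g) \<xi> * complex_of_real (exp (- (\<xi> / c)\<^sup>2 / 2)))"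
    by (simp add: fourier_autocorrelation[OF g] integral_complex_of_real[symmetric] del: integral_complex_of_real)
  also have "\<dots> = (LINT y|lborel. autocorrelation g y * complex_of_real (c * sqrt (2 * pi) * exp (- (2 * pi * c * y)\<^sup>2 / 2)))"
    by (simp only: fourier_multiplication[OF a integrable_gaussian[OF c]] fourier_gaussian[OF c])
  also have "\<dots> = (1 / (2 * pi * c)) *\<^sub>R (LINT z|lborel. autocorrelation g (z / (2 * pi * c)) * complex_of_real (c * sqrt (2 * pi) * exp (- z\<^sup>2 / 2)))"
    by (subst lborel_integral_real_affine[where c = "1 / (2 * pi * c)" and t = 0]) (use c in auto)
  also have "\<dots> = (LINT z|lborel. autocorrelation g (z / (2 * pi * c)) * complex_of_real (std_normal_density z))"
  proof -
    define r where "r = sqrt (2 * pi)"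
    have r: "0 < r" "2 * pi = r * r" by (auto simp: r_def)
    have "(1 / (2 * pi * c)) * (c * sqrt (2 * pi) * exp (- z\<^sup>2 / 2)) = std_normal_density z" for z
      unfolding std_normal_density_def r_def[symmetric] r(2) using c r(1) by (simp add: field_simps)
    then have "(1 / (2 * pi * c)) *\<^sub>R (x * complex_of_real (c * sqrt (2 * pi) * exp (- z\<^sup>2 / 2))) = x * complex_of_real (std_normal_density z)" for x z
      by (simp only: scaleR_conv_of_real mult.left_commute[of _ x] of_real_mult[symmetric])
    then show ?thesis by (subst integral_scaleR_right[symmetric]) simp
  qed
  finally have *: "complex_of_real (LINT \<xi>|lborel. (cmod (fourier g \<xi>))\<^sup>2 * exp (- (\<xi> / c)\<^sup>2 / 2)) = \<dots>" .
  have "integrable lborel (\<lambda>z. autocorrelation g (z / (2 * pi * c)))"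
    using lborel_integrable_real_affine[OF a, of "1 / (2 * pi * c)" 0] c by simp
  moreover have "std_normal_density z \<le> 1 / sqrt (2 * pi)" for z
    unfolding std_normal_density_def by (intro mult_left_le) auto
  ultimately have "integrable lborel (\<lambda>z. autocorrelation g (z / (2 * pi * c)) * complex_of_real (std_normal_density z))"
    by (intro integrable_mult_bounded[where C="1 / sqrt (2 * pi)"]) auto
  from integral_Re[OF this] arg_cong[OF *, of Re] show ?thesis by simp
qed

text \<open>Let the Gaussian weight widen to the constant \<open>1\<close>. The weighted energy increases to that of the
  transform, while the autocorrelation is averaged over ever smaller neighbourhoods of \<open>0\<close>, where
  its value is the energy of \<open>g\<close>.\<close>
theorem plancherel:
  assumes g: "integrable lborel g" and g2: "integrable lborel (\<lambda>t. (cmod (g t))\<^sup>2)"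
  shows "(\<integral>\<^sup>+ \<xi>. ennreal ((cmod (fourier g \<xi>))\<^sup>2) \<partial>lborel) = ennreal (LINT t|lborel. (cmod (g t))\<^sup>2)"
proof (rule LIMSEQ_unique)
  have [measurable]: "g \<in> borel_measurable borel" using g by auto
  have [measurable]: "autocorrelation g \<in> borel_measurable borel" using autocorrelation_integrable[OF g] by auto
  define W where "W n \<xi> = (cmod (fourier g \<xi>))\<^sup>2 * exp (- (\<xi> / real (Suc n))\<^sup>2 / 2)" for n \<xi>
  show "(\<lambda>n. \<integral>\<^sup>+ \<xi>. ennreal (W n \<xi>) \<partial>lborel) \<longlonglongrightarrow> (\<integral>\<^sup>+ \<xi>. ennreal ((cmod (fourier g \<xi>))\<^sup>2) \<partial>lborel)"
  proof (rule nn_integral_LIMSEQ)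
    show "incseq (\<lambda>n \<xi>. ennreal (W n \<xi>))"
    proof (intro incseq_SucI le_funI ennreal_leI)
      fix n \<xi>
      have "\<bar>\<xi> / real (Suc (Suc n))\<bar> \<le> \<bar>\<xi> / real (Suc n)\<bar>"
        by (simp add: abs_divide frac_le)
      then have "(\<xi> / real (Suc (Suc n)))\<^sup>2 \<le> (\<xi> / real (Suc n))\<^sup>2"
        by (simp only: abs_le_square_iff)
      then show "W n \<xi> \<le> W (Suc n) \<xi>"
        unfolding W_def by (intro mult_left_mono) auto
    qed
    show "(\<lambda>n. ennreal (W n \<xi>)) \<longlonglongrightarrow> ennreal ((cmod (fourier g \<xi>))\<^sup>2)" for \<xi>
    proof (rule tendsto_ennrealI)
      have "(\<lambda>n. \<xi> / real (Suc n)) \<longlonglongrightarrow> 0" by (rule LIMSEQ_Suc[OF lim_const_over_n])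
      then have "(\<lambda>n. W n \<xi>) \<longlonglongrightarrow> (cmod (fourier g \<xi>))\<^sup>2 * exp (- 0\<^sup>2 / 2)"
        unfolding W_def by (intro tendsto_intros) auto
      then show "(\<lambda>n. W n \<xi>) \<longlonglongrightarrow> (cmod (fourier g \<xi>))\<^sup>2" by simp
    qed
  qed (simp add: W_def)
  have "integrable lborel (W n)" for n
  proof -
    have *: "integrable lborel (\<lambda>\<xi>. exp (- (\<xi> / real (Suc n))\<^sup>2 / 2))"
      using integrable_gaussian[of "real (Suc n)"] by (simp only: of_nat_0_less_iff zero_less_Suc complex_of_real_integrable_eq)
    show ?thesis
    proof (rule Bochner_Integration.integrable_bound)
      show "integrable lborel (\<lambda>\<xi>. (LINT t|lborel. cmod (g t))\<^sup>2 * exp (- (\<xi> / real (Suc n))\<^sup>2 / 2))"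
        using * by simp
      show "AE \<xi> in lborel. norm (W n \<xi>) \<le> norm ((LINT t|lborel. cmod (g t))\<^sup>2 * exp (- (\<xi> / real (Suc n))\<^sup>2 / 2))"
        unfolding W_def using norm_fourier_le[of g] by (auto intro!: AE_I2 mult_right_mono power_mono simp: abs_mult)
    qed (simp add: W_def[abs_def])
  qed
  then have "(\<integral>\<^sup>+ \<xi>. ennreal (W n \<xi>) \<partial>lborel) = ennreal (LINT \<xi>|lborel. W n \<xi>)" for n
    by (rule nn_integral_eq_integral) (rule AE_I2, simp add: W_def)
  also have "(LINT \<xi>|lborel. W n \<xi>) = (LINT z|lborel. Re (autocorrelation g (z / (2 * pi * real (Suc n)))) * std_normal_density z)" for n
    unfolding W_def by (rule gaussian_mean_fourier_sq[OF g]) simp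
  moreover have "(\<lambda>n. LINT z|lborel. Re (autocorrelation g (z / (2 * pi * real (Suc n)))) * std_normal_density z)
     \<longlonglongrightarrow> (LINT z|lborel. (LINT t|lborel. (cmod (g t))\<^sup>2) * std_normal_density z)"
  proof (rule integral_dominated_convergence)
    have sn: "integrable lborel std_normal_density"
      using integrable_std_normal_moment[of 0] by simp
    then show "integrable lborel (\<lambda>z. (LINT t|lborel. (cmod (g t))\<^sup>2) * std_normal_density z)" by simp
    show "AE z in lborel. (\<lambda>n. Re (autocorrelation g (z / (2 * pi * real (Suc n)))) * std_normal_density z)
      \<longlonglongrightarrow> (LINT t|lborel. (cmod (g t))\<^sup>2) * std_normal_density z"
    proof (intro AE_I2 tendsto_mult tendsto_const Re_autocorrelation_tendsto g2)
      fix z :: real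
      have "(\<lambda>n. (z / (2 * pi)) / real (Suc n)) \<longlonglongrightarrow> 0" by (rule LIMSEQ_Suc[OF lim_const_over_n])
      then show "(\<lambda>n. z / (2 * pi * real (Suc n))) \<longlonglongrightarrow> 0" by simp
    qed simp
    show "AE z in lborel. norm (Re (autocorrelation g (z / (2 * pi * real (Suc n)))) * std_normal_density z)
      \<le> (LINT t|lborel. (cmod (g t))\<^sup>2) * std_normal_density z" for n
      using Re_autocorrelation_bound[OF _ g2] by (auto intro!: AE_I2 mult_right_mono simp: abs_mult)
  qed auto
  moreover have "(LINT z|lborel. std_normal_density z) = 1"
    using integral_std_normal_moment_even[of 0] by simp
  ultimately show "(\<lambda>n. \<integral>\<^sup>+ \<xi>. ennreal (W n \<xi>) \<partial>lborel) \<longlonglongrightarrow> ennreal (LINT t|lborel. (cmod (g t))\<^sup>2)"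
    by (auto intro!: tendsto_ennrealI)
qed

lemma fourier_diff:
  assumes "integrable lborel f" "integrable lborel g"
  shows "fourier (\<lambda>t. f t - g t) \<xi> = fourier f \<xi> - fourier g \<xi>"
proof -
  have "integrable lborel (\<lambda>t. f t * phase (t * \<xi>))" "integrable lborel (\<lambda>t. g t * phase (t * \<xi>))"
    using assms by (auto intro!: integrable_mult_bounded[where C=1])
  then show ?thesis by (simp add: fourier_def left_diff_distrib)
qed

text \<open>Shifting by half a period changes the sign of the exponential, so the transform at \<open>x\<close> is half
  the transform of \<open>g\<close> minus its translate by \<open>1 / (2 x)\<close>.\<close>
lemma riemann_lebesgue:
  assumes g: "integrable lborel g"
  shows "(\<lambda>m. fourier g (real (Suc m))) \<longlonglongrightarrow> 0"
proof (rule Lim_null_comparison)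
  define y where "y m = (1 / 2) / real (Suc m)" for m
  have "y \<longlonglongrightarrow> 0" unfolding y_def by (rule LIMSEQ_Suc[OF lim_const_over_n])
  from translation_L1_continuous[OF g this]
  show "(\<lambda>m. LINT t|lborel. norm (g (t + y m) - g t)) \<longlonglongrightarrow> 0" .
  have half: "phase (1 / 2) = - 1"
  proof -
    have "phase (1/2) = exp (- (of_real pi * \<i>))" by (simp add: phase_def)
    then show ?thesis by (simp add: exp_minus)
  qed
  have "norm (fourier g (real (Suc m))) \<le> (LINT t|lborel. norm (g (t + y m) - g t))" for m
  proof -
    let ?x = "real (Suc m)"
    have ph: "phase ((t + y m) * ?x) = - phase (t * ?x)" for t
    proof -
      have "(t + y m) * ?x = t * ?x + 1 / 2" by (simp add: y_def field_simps)
      then show ?thesis by (simp only: phase_add half) simp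
    qed
    have "fourier g ?x = (LINT t|lborel. g (t + y m) * phase ((t + y m) * ?x))"
      unfolding fourier_def by (rule integral_shift[symmetric, of "\<lambda>t. g t * phase (t * ?x)"])
    also have "\<dots> = - fourier (\<lambda>t. g (t + y m)) ?x" unfolding ph by (simp add: fourier_def)
    finally have "2 * fourier g ?x = - fourier (\<lambda>t. g (t + y m) - g t) ?x"
      by (simp add: fourier_diff[OF integrable_shift[OF g] g])
    then have "2 * norm (fourier g ?x) = norm (fourier (\<lambda>t. g (t + y m) - g t) ?x)"
      by (metis norm_minus_cancel norm_mult norm_numeral)
    then show ?thesis using norm_fourier_le[of "\<lambda>t. g (t + y m) - g t" ?x] norm_ge_zero[of "fourier g ?x"] by linarith
  qed
  then show "\<forall>\<^sub>F m in sequentially. norm (fourier g (real (Suc m))) \<le> (LINT t|lborel. norm (g (t + y m) - g t))"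
    by simp
qed

section \<open>Dispersion, means and tails\<close>

text \<open>The square of the dispersion about \<open>a\<close>, without the passage through real square roots.\<close>
definition moment :: "real \<Rightarrow> (real \<Rightarrow> complex) \<Rightarrow> real \<Rightarrow> ennreal" where
  "moment p h a = (\<integral>\<^sup>+ t. ennreal (\<bar>t - a\<bar> powr p * (cmod (h t))\<^sup>2) \<partial>lborel)"

lemma dispersion_about_moment:
  "dispersion_about p h a = (if moment p h a = \<infinity> then \<infinity> else ennreal (sqrt (enn2real (moment p h a))))"
  by (simp add: dispersion_about_def moment_def Let_def)

lemma moment_le_square:
  assumes "dispersion_about p h a \<le> ennreal M" "0 \<le> M"
  shows "moment p h a \<le> ennreal (M\<^sup>2)"
proof -
  have fin: "moment p h a \<noteq> \<infinity>"
    using assms(1) by (auto simp: dispersion_about_moment top_unique)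
  then have "ennreal (sqrt (enn2real (moment p h a))) \<le> ennreal M"
    using assms(1) by (simp add: dispersion_about_moment)
  then have "sqrt (enn2real (moment p h a)) \<le> M" using assms(2) by simp
  then have "enn2real (moment p h a) \<le> M\<^sup>2"
    using power_mono[of "sqrt (enn2real (moment p h a))" M 2] by simp
  then have "ennreal (enn2real (moment p h a)) \<le> ennreal (M\<^sup>2)" by (rule ennreal_leI)
  then show ?thesis using fin by (simp add: ennreal_enn2real_if)
qed

lemma chebyshev_moment_tail:
  assumes [measurable]: "h \<in> borel_measurable borel" and "0 < r" "0 \<le> \<eta>"
    and "moment p h a \<le> ennreal (\<eta> * r powr p)" "0 \<le> p"
  shows "(\<integral>\<^sup>+ t. ennreal ((cmod (h t))\<^sup>2) * indicator {t. r < \<bar>t - a\<bar>} t \<partial>lborel) \<le> ennreal \<eta>"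
proof -
  have "ennreal (r powr p) * (\<integral>\<^sup>+ t. ennreal ((cmod (h t))\<^sup>2) * indicator {t. r < \<bar>t - a\<bar>} t \<partial>lborel)
    = (\<integral>\<^sup>+ t. ennreal (r powr p) * (ennreal ((cmod (h t))\<^sup>2) * indicator {t. r < \<bar>t - a\<bar>} t) \<partial>lborel)"
    by (rule nn_integral_cmult[symmetric]) measurable
  also have "\<dots> \<le> moment p h a"
    unfolding moment_def
    using assms(2,5) by (intro nn_integral_mono)
      (auto split: split_indicator simp: ennreal_mult[symmetric] intro!: ennreal_leI mult_right_mono powr_mono2)
  also have "\<dots> \<le> ennreal (r powr p) * ennreal \<eta>"
    using assms(3,4) by (simp add: ennreal_mult[symmetric] mult.commute)
  finally show ?thesis using assms(2) by (simp add: ennreal_mult_le_mult_iff)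
qed

text \<open>The radius depends on the bound of the moment only, not on \<open>h\<close> or \<open>a\<close>, and the
  tolerance \<open>1/16\<close> is the one for which \<open>local_energy_ge_half\<close> leaves half of the energy.\<close>
lemma uniform_tail:
  assumes [measurable]: "h \<in> borel_measurable borel" and "0 < M" "0 < p"
    and "moment p h a \<le> ennreal M"
  shows "(\<integral>\<^sup>+ t. ennreal ((cmod (h t))\<^sup>2) * indicator {t. (16 * M) powr (1 / p) < \<bar>t - a\<bar>} t \<partial>lborel) \<le> ennreal (1/16)"
  by (rule chebyshev_moment_tail[where p=p]) (use assms in \<open>auto simp: powr_powr\<close>)

lemma abs_add_powr_le:
  fixes x y p :: real
  assumes "0 \<le> p"
  shows "\<bar>x + y\<bar> powr p \<le> 2 powr p * (\<bar>x\<bar> powr p + \<bar>y\<bar> powr p)"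
proof -
  have "\<bar>x + y\<bar> powr p \<le> (2 * max \<bar>x\<bar> \<bar>y\<bar>) powr p"
    using assms by (intro powr_mono2) auto
  also have "\<dots> = 2 powr p * max \<bar>x\<bar> \<bar>y\<bar> powr p" by (rule powr_mult)
  also have "\<dots> \<le> 2 powr p * (\<bar>x\<bar> powr p + \<bar>y\<bar> powr p)"
    by (intro mult_left_mono) (auto simp: max_def)
  finally show ?thesis .
qed

text \<open>The mean value theorem on both halves of the interval: the derivative of \<open>x\<^sup>p\<close> is strictly
  increasing. At the left end point, which may be \<open>0\<close>, only continuity enters.\<close>
lemma powr_strict_midpoint_less:
  fixes s t p :: real
  assumes "0 \<le> s" "s < t" "1 < p"
  shows "((s + t) / 2) powr p < (s powr p + t powr p) / 2"
proof -
  define m where "m = (s + t) / 2"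
  have m: "s < m" "m < t" "m - s = (t - s) / 2" "t - m = (t - s) / 2" "0 < m"
    using assms by (auto simp: m_def field_simps)
  have deriv: "((\<lambda>x. x powr p) has_real_derivative p * z powr (p - 1)) (at z)" if "0 < z" for z
    using that by (auto intro!: derivative_eq_intros)
  have mvt: "\<exists>z. a < z \<and> z < b \<and> b powr p - a powr p = (b - a) * (p * z powr (p - 1))" if "0 \<le> a" "a < b" for a b
  proof -
    have "\<exists>l z. a < z \<and> z < b \<and> DERIV (\<lambda>x. x powr p) z :> l \<and> b powr p - a powr p = (b - a) * l"
    proof (rule MVT[OF \<open>a < b\<close>])
      show "continuous_on {a..b} (\<lambda>x. x powr p)"
        using that assms by (intro continuous_on_powr' continuous_intros) auto
      show "(\<lambda>x. x powr p) differentiable (at x)" if "a < x" "x < b" for x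
        using deriv[of x] that \<open>0 \<le> a\<close> real_differentiable_def by force
    qed
    then obtain l z where z: "a < z" "z < b" "DERIV (\<lambda>x. x powr p) z :> l" "b powr p - a powr p = (b - a) * l" by blast
    moreover have "l = p * z powr (p - 1)" using DERIV_unique[OF z(3) deriv] z that by simp
    ultimately show ?thesis by blast
  qed
  obtain z1 where z1: "s < z1" "z1 < m" "m powr p - s powr p = (m - s) * (p * z1 powr (p - 1))"
    using mvt[of s m] assms m by auto
  obtain z2 where z2: "m < z2" "z2 < t" "t powr p - m powr p = (t - m) * (p * z2 powr (p - 1))"
    using mvt[of m t] assms m by auto
  have "z1 powr (p - 1) < z2 powr (p - 1)"
    using z1 z2 assms by (intro powr_less_mono2) auto
  then have "m powr p - s powr p < t powr p - m powr p"
    unfolding z1(3) z2(3) m(3,4) using assms by simp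
  then show ?thesis by (simp add: m_def[symmetric])
qed

lemma abs_powr_strict_midpoint:
  fixes x y p :: real
  assumes "x \<noteq> y" "1 < p"
  shows "\<bar>(x + y) / 2\<bar> powr p < (\<bar>x\<bar> powr p + \<bar>y\<bar> powr p) / 2"
proof (cases "\<bar>x\<bar> = \<bar>y\<bar>")
  case True
  then have "y = - x" "x \<noteq> 0" using assms by (auto simp: abs_eq_iff)
  then show ?thesis by simp
next
  case False
  have "\<bar>(x + y) / 2\<bar> powr p \<le> ((\<bar>x\<bar> + \<bar>y\<bar>) / 2) powr p"
    using assms by (intro powr_mono2) auto
  also have "\<dots> < (\<bar>x\<bar> powr p + \<bar>y\<bar> powr p) / 2"
    using powr_strict_midpoint_less[of "\<bar>x\<bar>" "\<bar>y\<bar>" p] powr_strict_midpoint_less[of "\<bar>y\<bar>" "\<bar>x\<bar>" p] False assms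
    by (cases "\<bar>x\<bar> < \<bar>y\<bar>") (auto simp: add.commute)
  finally show ?thesis .
qed

text \<open>The moment as a function of the centre is finite, continuous and coercive, so it attains its
  minimum; by strict convexity of \<open>\<bar>x\<bar>\<^sup>p\<close> two minimisers would have a strictly better midpoint.\<close>
lemma ex1_moment_minimiser:
  assumes h: "h \<in> L2" and h1: "(LINT t|lborel. (cmod (h t))\<^sup>2) = 1" and p: "1 < p"
    and fin: "moment p h a0 < \<infinity>"
  shows "\<exists>c. moment p h c < \<infinity> \<and> (\<forall>a. moment p h c \<le> moment p h a) \<and>
    (\<forall>a. moment p h a = moment p h c \<longrightarrow> a = c)"
proof -
  have [measurable]: "h \<in> borel_measurable borel" and h2: "integrable lborel (\<lambda>t. (cmod (h t))\<^sup>2)"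
    using h by (auto simp: L2_def)
  define J where "J a = (LINT t|lborel. \<bar>t - a\<bar> powr p * (cmod (h t))\<^sup>2)" for a
  have int0: "integrable lborel (\<lambda>t. \<bar>t - a0\<bar> powr p * (cmod (h t))\<^sup>2)"
    using fin by (intro integrableI_nonneg) (auto simp: moment_def)
  have split: "\<bar>t - a\<bar> powr p * (cmod (h t))\<^sup>2
      \<le> 2 powr p * (\<bar>t - b\<bar> powr p * (cmod (h t))\<^sup>2 + \<bar>b - a\<bar> powr p * (cmod (h t))\<^sup>2)" for t a b
    using mult_right_mono[OF abs_add_powr_le[of p "t - b" "b - a"], of "(cmod (h t))\<^sup>2"] p
    by (simp add: algebra_simps)
  have int: "integrable lborel (\<lambda>t. \<bar>t - a\<bar> powr p * (cmod (h t))\<^sup>2)" for a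
  proof (rule Bochner_Integration.integrable_bound)
    show "integrable lborel (\<lambda>t. 2 powr p * (\<bar>t - a0\<bar> powr p * (cmod (h t))\<^sup>2 + \<bar>a0 - a\<bar> powr p * (cmod (h t))\<^sup>2))"
      using int0 h2 by simp
    show "AE t in lborel. norm (\<bar>t - a\<bar> powr p * (cmod (h t))\<^sup>2)
      \<le> norm (2 powr p * (\<bar>t - a0\<bar> powr p * (cmod (h t))\<^sup>2 + \<bar>a0 - a\<bar> powr p * (cmod (h t))\<^sup>2))"
      using split[of _ a a0] by (intro AE_I2) simp
  qed measurable
  have mJ: "moment p h a = ennreal (J a)" for a
    unfolding moment_def J_def by (rule nn_integral_eq_integral[OF int]) simp
  have J0: "0 \<le> J a" for a unfolding J_def by simp
  have coercive: "\<bar>a\<bar> powr p \<le> 2 powr p * (J a + J 0)" for a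
  proof -
    have "\<bar>a\<bar> powr p = (LINT t|lborel. \<bar>a\<bar> powr p * (cmod (h t))\<^sup>2)" by (simp add: h1)
    also have "\<dots> \<le> (LINT t|lborel. 2 powr p * (\<bar>t - a\<bar> powr p * (cmod (h t))\<^sup>2 + \<bar>t - 0\<bar> powr p * (cmod (h t))\<^sup>2))"
    proof (rule integral_mono)
      fix t
      show "\<bar>a\<bar> powr p * (cmod (h t))\<^sup>2 \<le> 2 powr p * (\<bar>t - a\<bar> powr p * (cmod (h t))\<^sup>2 + \<bar>t - 0\<bar> powr p * (cmod (h t))\<^sup>2)"
        using mult_right_mono[OF abs_add_powr_le[of p "t" "a - t"], of "(cmod (h t))\<^sup>2"] p
        by (simp add: algebra_simps abs_minus_commute)
    qed (use h2 int[of a] int[of 0] in auto)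
    also have "\<dots> = 2 powr p * (J a + J 0)"
      using int[of a] int[of 0] by (simp add: J_def)
    finally show ?thesis .
  qed
  have cont: "continuous_on {-K..K} J" for K
    unfolding continuous_on_sequentially
  proof (intro ballI allI impI)
    fix x a assume "a \<in> {-K..K}" and x: "(\<forall>n. x n \<in> {-K..K}) \<and> x \<longlonglongrightarrow> a"
    show "(J \<circ> x) \<longlonglongrightarrow> J a"
      unfolding comp_def J_def
    proof (rule integral_dominated_convergence)
      show "integrable lborel (\<lambda>t. 2 powr p * (\<bar>t - 0\<bar> powr p * (cmod (h t))\<^sup>2 + K powr p * (cmod (h t))\<^sup>2))"
        using int[of 0] h2 by simp
      show "AE t in lborel. (\<lambda>n. \<bar>t - x n\<bar> powr p * (cmod (h t))\<^sup>2) \<longlonglongrightarrow> \<bar>t - a\<bar> powr p * (cmod (h t))\<^sup>2"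
        using p x by (intro AE_I2 tendsto_intros) auto
      show "AE t in lborel. norm (\<bar>t - x n\<bar> powr p * (cmod (h t))\<^sup>2)
         \<le> 2 powr p * (\<bar>t - 0\<bar> powr p * (cmod (h t))\<^sup>2 + K powr p * (cmod (h t))\<^sup>2)" for n
      proof (rule AE_I2)
        fix t
        have "x n \<in> {-K..K}" using x by blast
        then have "\<bar>0 - x n\<bar> powr p \<le> K powr p" using p by (intro powr_mono2) auto
        then have "\<bar>0 - x n\<bar> powr p * (cmod (h t))\<^sup>2 \<le> K powr p * (cmod (h t))\<^sup>2"
          by (rule mult_right_mono) simp
        then have "2 powr p * (\<bar>t - 0\<bar> powr p * (cmod (h t))\<^sup>2 + \<bar>0 - x n\<bar> powr p * (cmod (h t))\<^sup>2)
          \<le> 2 powr p * (\<bar>t - 0\<bar> powr p * (cmod (h t))\<^sup>2 + K powr p * (cmod (h t))\<^sup>2)"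
          by (intro mult_left_mono) auto
        from order_trans[OF split[of t "x n" 0] this]
        show "norm (\<bar>t - x n\<bar> powr p * (cmod (h t))\<^sup>2)
         \<le> 2 powr p * (\<bar>t - 0\<bar> powr p * (cmod (h t))\<^sup>2 + K powr p * (cmod (h t))\<^sup>2)" by simp
      qed
    qed measurable
  qed
  \<comment> \<open>Coercivity: beyond distance K the moment exceeds its value at 0.\<close>
  define K where "K = (2 powr p * (2 * J 0)) powr (1 / p)"
  have K: "0 \<le> K" "K powr p = 2 powr p * (2 * J 0)"
    using p J0[of 0] by (auto simp: K_def powr_powr)
  obtain c where c: "c \<in> {-K..K}" "\<And>a. a \<in> {-K..K} \<Longrightarrow> J c \<le> J a"
    using continuous_attains_inf[OF compact_Icc _ cont[of K]] K(1) by force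
  have min: "J c \<le> J a" for a
  proof (cases "a \<in> {-K..K}")
    case False
    then have "K < \<bar>a\<bar>" by auto
    then have "K powr p < \<bar>a\<bar> powr p" using p K(1) by (intro powr_less_mono2) auto
    then have "2 powr p * (2 * J 0) < 2 powr p * (J a + J 0)" using coercive[of a] K(2) by linarith
    then have "2 * J 0 < J a + J 0" by (rule mult_left_less_imp_less) simp
    then show ?thesis using c(2)[of 0] K(1) by simp
  qed (rule c(2))
  have uniq: "a = c" if "J a = J c" for a
  proof (rule ccontr)
    assume "a \<noteq> c"
    define D where "D t = (\<bar>t - a\<bar> powr p + \<bar>t - c\<bar> powr p) / 2 - \<bar>t - (a + c) / 2\<bar> powr p" for t
    have D: "0 < D t" for t
      using abs_powr_strict_midpoint[of "t - a" "t - c" p] \<open>a \<noteq> c\<close> p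
      by (simp add: D_def) (simp add: field_simps)
    have eqD: "D t * (cmod (h t))\<^sup>2 = (\<bar>t - a\<bar> powr p * (cmod (h t))\<^sup>2 + \<bar>t - c\<bar> powr p * (cmod (h t))\<^sup>2) / 2
        - \<bar>t - (a + c) / 2\<bar> powr p * (cmod (h t))\<^sup>2" for t
      by (simp add: D_def field_simps)
    have intD: "integrable lborel (\<lambda>t. D t * (cmod (h t))\<^sup>2)"
      unfolding eqD using int[of a] int[of c] int[of "(a + c) / 2"] by simp
    have "(LINT t|lborel. D t * (cmod (h t))\<^sup>2) = (J a + J c) / 2 - J ((a + c) / 2)"
      unfolding eqD J_def using int[of a] int[of c] int[of "(a + c) / 2"] by simp
    also have "\<dots> \<le> 0" using min[of "(a + c) / 2"] that by simp
    finally have le: "(LINT t|lborel. D t * (cmod (h t))\<^sup>2) \<le> 0" .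
    have D0: "AE t in lborel. 0 \<le> D t * (cmod (h t))\<^sup>2" using D by (intro AE_I2) (simp add: less_imp_le)
    have "(LINT t|lborel. D t * (cmod (h t))\<^sup>2) = 0"
      using le integral_nonneg_AE[OF D0] by simp
    then have "AE t in lborel. D t * (cmod (h t))\<^sup>2 = 0"
      using integral_nonneg_eq_0_iff_AE[OF intD D0] by simp
    then have "AE t in lborel. (cmod (h t))\<^sup>2 = 0"
      by eventually_elim (use D in \<open>auto simp: less_le\<close>)
    from integral_cong_AE[OF _ _ this] have "(LINT t|lborel. (cmod (h t))\<^sup>2) = 0" by simp
    then show False using h1 by simp
  qed
  show ?thesis
    using min uniq J0 by (intro exI[of _ c]) (auto simp: mJ ennreal_leI)
qed

text \<open>The definite description in the definition of the \<open>p\<close>-mean denotes an actual minimiser only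
  because there is exactly one.\<close>
lemma dispersion_about_p_mean:
  assumes h: "h \<in> L2" and h1: "L2_norm h = 1" and p: "1 < p"
    and fin: "dispersion p h < \<infinity>"
  shows "dispersion_about p h (p_mean p h) = dispersion p h"
proof -
  obtain a0 where "dispersion_about p h a0 < \<infinity>"
    using fin unfolding dispersion_def INF_less_iff by auto
  then have "moment p h a0 < \<infinity>" by (auto simp: dispersion_about_moment less_top split: if_splits)
  moreover have "(LINT t|lborel. (cmod (h t))\<^sup>2) = 1" using h1 by (simp add: L2_norm_def)
  ultimately obtain c where c: "moment p h c < \<infinity>" "\<And>a. moment p h c \<le> moment p h a"
    "\<And>a. moment p h a = moment p h c \<Longrightarrow> a = c"
    using ex1_moment_minimiser[OF h _ p] by blast
  have mono: "dispersion_about p h c \<le> dispersion_about p h a" for a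
    using c(1) c(2)[of a] by (auto simp: dispersion_about_moment less_top intro!: ennreal_leI enn2real_mono)
  have disp: "dispersion_about p h c = dispersion p h"
    unfolding dispersion_def by (intro antisym INF_greatest INF_lower mono) simp
  have "a = c" if "dispersion_about p h a = dispersion p h" for a
  proof (rule c(3))
    have eq: "dispersion_about p h a = dispersion_about p h c" using that disp by simp
    then have a: "moment p h a \<noteq> \<infinity>" using c(1) by (auto simp: dispersion_about_moment split: if_splits)
    then have "enn2real (moment p h a) = enn2real (moment p h c)"
      using eq c(1) by (simp add: dispersion_about_moment less_top[symmetric])
    then show "moment p h a = moment p h c"
      using a c(1) by (metis ennreal_enn2real less_top infinity_ennreal_def)
  qed
  then show ?thesis unfolding p_mean_def using disp by (rule theI[where a=c, rotated])
qed

section \<open>Truncations and the Fourier transform on the space of square-integrable functions\<close>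

lemma L2_D:
  assumes "f \<in> L2"
  shows "f \<in> borel_measurable borel" "integrable lborel (\<lambda>t. (cmod (f t))\<^sup>2)"
  using assms by (auto simp: L2_def)

definition restrict_to :: "real set \<Rightarrow> (real \<Rightarrow> complex) \<Rightarrow> real \<Rightarrow> complex" where
  "restrict_to S f t = indicat_real S t *\<^sub>R f t"

lemma restrict_to_measurable [measurable]:
  assumes [measurable]: "S \<in> sets borel" "f \<in> borel_measurable borel"
  shows "restrict_to S f \<in> borel_measurable borel"
  unfolding restrict_to_def[abs_def] by measurable

lemma norm_restrict_to: "cmod (restrict_to S f t) = indicat_real S t * cmod (f t)"
  by (simp add: restrict_to_def)

lemma integrable_sq_restrict:
  assumes f: "f \<in> L2" and [measurable]: "S \<in> sets borel"
  shows "integrable lborel (\<lambda>t. (cmod (restrict_to S f t))\<^sup>2)"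
proof (rule Bochner_Integration.integrable_bound[OF L2_D(2)[OF f]])
  have [measurable]: "f \<in> borel_measurable borel" by (rule L2_D[OF f])
  show "(\<lambda>t. (cmod (restrict_to S f t))\<^sup>2) \<in> borel_measurable lborel" by measurable
qed (auto simp: norm_restrict_to split: split_indicator)

lemma integrable_restrict:
  assumes f: "f \<in> L2" and [measurable]: "S \<in> sets borel" and S: "S \<subseteq> {a..b}"
  shows "integrable lborel (restrict_to S f)"
proof (rule Bochner_Integration.integrable_bound)
  have [measurable]: "f \<in> borel_measurable borel" by (rule L2_D[OF f])
  have "emeasure lborel S \<le> emeasure lborel {a..b}" using S by (intro emeasure_mono) auto
  also have "\<dots> < \<infinity>" by (simp add: emeasure_lborel_Icc_eq)
  finally have "integrable lborel (indicat_real S)" by (simp add: integrable_indicator_iff)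
  then show "integrable lborel (\<lambda>t. indicat_real S t + (cmod (f t))\<^sup>2)"
    using L2_D(2)[OF f] by simp
  have "x \<le> 1 + x\<^sup>2" for x :: real
  proof -
    have "2 * x \<le> x\<^sup>2 + 1" using zero_le_power2[of "x - 1"] unfolding power2_diff by simp
    then show ?thesis using zero_le_power2[of x] by linarith
  qed
  then show "AE t in lborel. cmod (restrict_to S f t) \<le> norm (indicat_real S t + (cmod (f t))\<^sup>2)"
    by (intro AE_I2) (auto simp: norm_restrict_to split: split_indicator)
  show "restrict_to S f \<in> borel_measurable lborel" by simp
qed

lemma truncated_fourier_eq: "truncated_fourier R f = fourier (restrict_to {-R..R} f)"
  by (rule ext) (simp add: truncated_fourier_def fourier_def set_lebesgue_integral_def restrict_to_def phase_def)

lemma plancherel_restrict: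
  assumes f: "f \<in> L2" and [measurable]: "S \<in> sets borel" and S: "S \<subseteq> {a..b}"
  shows "(\<integral>\<^sup>+ \<xi>. ennreal ((cmod (fourier (restrict_to S f) \<xi>))\<^sup>2) \<partial>lborel)
    = (\<integral>\<^sup>+ t. ennreal ((cmod (f t))\<^sup>2) * indicator S t \<partial>lborel)"
proof -
  have "(\<integral>\<^sup>+ \<xi>. ennreal ((cmod (fourier (restrict_to S f) \<xi>))\<^sup>2) \<partial>lborel)
     = ennreal (LINT t|lborel. (cmod (restrict_to S f t))\<^sup>2)"
    by (rule plancherel[OF integrable_restrict integrable_sq_restrict]) (use assms in auto)
  also have "\<dots> = (\<integral>\<^sup>+ t. ennreal ((cmod (restrict_to S f t))\<^sup>2) \<partial>lborel)"
    by (rule nn_integral_eq_integral[symmetric, OF integrable_sq_restrict]) (use assms in auto)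
  also have "\<dots> = (\<integral>\<^sup>+ t. ennreal ((cmod (f t))\<^sup>2) * indicator S t \<partial>lborel)"
    by (intro nn_integral_cong) (auto simp: norm_restrict_to split: split_indicator)
  finally show ?thesis .
qed

lemma norm_add_sq_le: "(norm (x + y))\<^sup>2 \<le> 2 * (norm x)\<^sup>2 + 2 * (norm (y :: 'a :: real_normed_vector))\<^sup>2"
proof -
  have "(norm (x + y))\<^sup>2 \<le> (norm x + norm y)\<^sup>2" by (intro power_mono norm_triangle_ineq) simp
  also have "\<dots> \<le> 2 * (norm x)\<^sup>2 + 2 * (norm y)\<^sup>2"
    using zero_le_power2[of "norm x - norm y"] unfolding power2_sum power2_diff by simp
  finally show ?thesis .
qed

lemma nn_integral_norm_add_sq_le:
  fixes f g :: "'a \<Rightarrow> complex"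
  assumes [measurable]: "f \<in> borel_measurable M" "g \<in> borel_measurable M" "S \<in> sets M"
  shows "(\<integral>\<^sup>+ x. ennreal ((cmod (f x + g x))\<^sup>2) * indicator S x \<partial>M)
    \<le> 2 * (\<integral>\<^sup>+ x. ennreal ((cmod (f x))\<^sup>2) * indicator S x \<partial>M) + 2 * (\<integral>\<^sup>+ x. ennreal ((cmod (g x))\<^sup>2) * indicator S x \<partial>M)"
proof -
  have "(\<integral>\<^sup>+ x. ennreal ((cmod (f x + g x))\<^sup>2) * indicator S x \<partial>M)
    \<le> (\<integral>\<^sup>+ x. 2 * (ennreal ((cmod (f x))\<^sup>2) * indicator S x) + 2 * (ennreal ((cmod (g x))\<^sup>2) * indicator S x) \<partial>M)"
  proof (rule nn_integral_mono)
    fix x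
    have "ennreal ((cmod (f x + g x))\<^sup>2) \<le> ennreal (2 * (cmod (f x))\<^sup>2 + 2 * (cmod (g x))\<^sup>2)"
      by (intro ennreal_leI norm_add_sq_le)
    also have "\<dots> = 2 * ennreal ((cmod (f x))\<^sup>2) + 2 * ennreal ((cmod (g x))\<^sup>2)"
      by (simp add: ennreal_plus ennreal_mult)
    finally show "ennreal ((cmod (f x + g x))\<^sup>2) * indicator S x \<le>
      2 * (ennreal ((cmod (f x))\<^sup>2) * indicator S x) + 2 * (ennreal ((cmod (g x))\<^sup>2) * indicator S x)"
      by (auto split: split_indicator)
  qed
  also have "\<dots> = 2 * (\<integral>\<^sup>+ x. ennreal ((cmod (f x))\<^sup>2) * indicator S x \<partial>M) + 2 * (\<integral>\<^sup>+ x. ennreal ((cmod (g x))\<^sup>2) * indicator S x \<partial>M)"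
    by (subst nn_integral_add) (simp_all add: nn_integral_cmult)
  finally show ?thesis .
qed

text \<open>By Plancherel's theorem two truncated transforms with limits \<open>T \<le> R\<close> differ by at most the tail
  energy beyond \<open>T\<close>; then \<open>R\<close> tends to infinity. The factor \<open>2\<close> comes from using
  \<open>\<bar>x + y\<bar>\<^sup>2 \<le> 2 \<bar>x\<bar>\<^sup>2 + 2 \<bar>y\<bar>\<^sup>2\<close> in place of the triangle inequality of \<open>L\<^sup>2\<close>.\<close>
lemma truncated_fourier_error:
  assumes ft: "has_L2_fourier_transform f g"
  shows "(\<integral>\<^sup>+ \<xi>. ennreal ((cmod (truncated_fourier T f \<xi> - g \<xi>))\<^sup>2) \<partial>lborel)
    \<le> 2 * (\<integral>\<^sup>+ t. ennreal ((cmod (f t))\<^sup>2) * indicator {t. T < \<bar>t\<bar>} t \<partial>lborel)"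
    (is "?E T \<le> 2 * ?tail")
proof -
  have f: "f \<in> L2" and g: "g \<in> L2" and lim: "((\<lambda>R. ?E R) \<longlongrightarrow> 0) at_top"
    using ft by (auto simp: has_L2_fourier_transform_def)
  note [measurable] = L2_D(1)[OF f] L2_D(1)[OF g]
  have "((\<lambda>R. 2 * ?E R + 2 * ?tail) \<longlongrightarrow> 2 * 0 + 2 * ?tail) at_top"
    by (intro tendsto_add tendsto_const ennreal_tendsto_cmult lim) simp
  moreover have "\<forall>\<^sub>F R in at_top. ?E T \<le> 2 * ?E R + 2 * ?tail"
    using eventually_ge_at_top[of T]
  proof eventually_elim
    case (elim R)
    define S where "S = {-R..R} - {-T..T}"
    have [measurable]: "S \<in> sets borel" by (simp add: S_def)
    have "restrict_to S f = (\<lambda>t. restrict_to {-R..R} f t - restrict_to {-T..T} f t)"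
      using elim by (auto simp: restrict_to_def S_def fun_eq_iff split: split_indicator)
    then have "fourier (restrict_to S f) \<xi> = truncated_fourier R f \<xi> - truncated_fourier T f \<xi>" for \<xi>
      unfolding truncated_fourier_eq
      by (subst fourier_diff[symmetric]) (auto intro!: integrable_restrict f)
    then have eq: "truncated_fourier T f \<xi> - g \<xi> = (truncated_fourier R f \<xi> - g \<xi>) + - fourier (restrict_to S f) \<xi>" for \<xi>
      by simp
    have [measurable]: "truncated_fourier R f \<in> borel_measurable borel" for R
      unfolding truncated_fourier_eq by measurable
    have "?E T \<le> 2 * ?E R + 2 * (\<integral>\<^sup>+ \<xi>. ennreal ((cmod (fourier (restrict_to S f) \<xi>))\<^sup>2) \<partial>lborel)"
      using nn_integral_norm_add_sq_le[of "\<lambda>\<xi>. truncated_fourier R f \<xi> - g \<xi>" lborel "\<lambda>\<xi>. - fourier (restrict_to S f) \<xi>" UNIV]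
      unfolding eq by simp
    also have "(\<integral>\<^sup>+ \<xi>. ennreal ((cmod (fourier (restrict_to S f) \<xi>))\<^sup>2) \<partial>lborel) = (\<integral>\<^sup>+ t. ennreal ((cmod (f t))\<^sup>2) * indicator S t \<partial>lborel)"
      by (rule plancherel_restrict[OF f]) (auto simp: S_def)
    also have "\<dots> \<le> ?tail"
      by (intro nn_integral_mono) (auto simp: S_def split: split_indicator)
    finally show ?case by (simp add: add_left_mono mult_left_mono)
  qed
  ultimately have "?E T \<le> 2 * 0 + 2 * ?tail"
    by (intro tendsto_lowerbound[OF _ _ trivial_limit_at_top_linorder])
  then show ?thesis by simp
qed

lemma L2_unit_energy:
  assumes "f \<in> L2" "L2_norm f = 1"
  shows "(\<integral>\<^sup>+ t. ennreal ((cmod (f t))\<^sup>2) \<partial>lborel) = 1"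
  using nn_integral_eq_integral[OF L2_D(2)[OF assms(1)]] assms(2) by (simp add: L2_norm_def)

text \<open>Any bound independent of \<open>f\<close> suffices below, so the truncation at \<open>0\<close> is good enough. The constant is
  \<open>2 + 4\<close>, from the energy of the truncation and from the truncation error.\<close>
lemma fourier_transform_energy_le:
  assumes ft: "has_L2_fourier_transform f g" and f1: "L2_norm f = 1"
  shows "(\<integral>\<^sup>+ \<xi>. ennreal ((cmod (g \<xi>))\<^sup>2) \<partial>lborel) \<le> 6"
proof -
  have f: "f \<in> L2" and g: "g \<in> L2" using ft by (auto simp: has_L2_fourier_transform_def)
  note [measurable] = L2_D(1)[OF f] L2_D(1)[OF g]
  have [measurable]: "truncated_fourier R f \<in> borel_measurable borel" for R
    unfolding truncated_fourier_eq by measurable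
  let ?T = "\<lambda>\<xi>. truncated_fourier 0 f \<xi>"
  have le1: "(\<integral>\<^sup>+ t. ennreal ((cmod (f t))\<^sup>2) * indicator S t \<partial>lborel) \<le> 1" for S
    unfolding L2_unit_energy[OF f f1, symmetric]
    by (intro nn_integral_mono) (auto split: split_indicator)
  have "(\<integral>\<^sup>+ \<xi>. ennreal ((cmod (g \<xi>))\<^sup>2) \<partial>lborel)
    \<le> 2 * (\<integral>\<^sup>+ \<xi>. ennreal ((cmod (?T \<xi>))\<^sup>2) \<partial>lborel) + 2 * (\<integral>\<^sup>+ \<xi>. ennreal ((cmod (?T \<xi> - g \<xi>))\<^sup>2) \<partial>lborel)"
    using nn_integral_norm_add_sq_le[of ?T lborel "\<lambda>\<xi>. g \<xi> - ?T \<xi>" UNIV]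
    by (simp add: norm_minus_commute)
  also have "\<dots> \<le> 2 * 1 + 2 * (2 * 1)"
  proof (intro add_mono mult_left_mono)
    show "(\<integral>\<^sup>+ \<xi>. ennreal ((cmod (?T \<xi>))\<^sup>2) \<partial>lborel) \<le> 1"
      unfolding truncated_fourier_eq by (subst plancherel_restrict[OF f, of _ 0 0]) (auto intro: le1)
    show "(\<integral>\<^sup>+ \<xi>. ennreal ((cmod (?T \<xi> - g \<xi>))\<^sup>2) \<partial>lborel) \<le> 2 * 1"
      by (rule order_trans[OF truncated_fourier_error[OF ft] mult_left_mono[OF le1]]) simp
  qed auto
  finally show ?thesis by simp
qed

text \<open>The truncated transform has energy at least \<open>15/16\<close> by Plancherel's theorem. Away from \<open>b\<close> it is
  close to \<open>g\<close>, which has little energy there: at most \<open>2 (2/16) + 2 (1/16) = 3/8\<close> is lost.\<close>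
lemma local_energy_ge_half:
  assumes ft: "has_L2_fourier_transform f g" and f1: "L2_norm f = 1"
    and time: "(\<integral>\<^sup>+ t. ennreal ((cmod (f t))\<^sup>2) * indicator {t. T < \<bar>t\<bar>} t \<partial>lborel) \<le> ennreal (1/16)"
    and freq: "(\<integral>\<^sup>+ \<xi>. ennreal ((cmod (g \<xi>))\<^sup>2) * indicator {\<xi>. B < \<bar>\<xi> - b\<bar>} \<xi> \<partial>lborel) \<le> ennreal (1/16)"
  shows "ennreal (1/2) \<le> (\<integral>\<^sup>+ \<xi>. ennreal ((cmod (truncated_fourier T f \<xi>))\<^sup>2) * indicator {\<xi>. \<bar>\<xi> - b\<bar> \<le> B} \<xi> \<partial>lborel)"
    (is "_ \<le> ?X")
proof -
  have f: "f \<in> L2" and g: "g \<in> L2" using ft by (auto simp: has_L2_fourier_transform_def)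
  note [measurable] = L2_D(1)[OF f] L2_D(1)[OF g]
  have [measurable]: "truncated_fourier R f \<in> borel_measurable borel" for R
    unfolding truncated_fourier_eq by measurable
  let ?t = "\<lambda>\<xi>. truncated_fourier T f \<xi>" and ?out = "{\<xi>. B < \<bar>\<xi> - b\<bar>}"
  have "(\<integral>\<^sup>+ \<xi>. ennreal ((cmod (?t \<xi>))\<^sup>2) * indicator ?out \<xi> \<partial>lborel)
    \<le> 2 * (\<integral>\<^sup>+ \<xi>. ennreal ((cmod (?t \<xi> - g \<xi>))\<^sup>2) * indicator ?out \<xi> \<partial>lborel)
     + 2 * (\<integral>\<^sup>+ \<xi>. ennreal ((cmod (g \<xi>))\<^sup>2) * indicator ?out \<xi> \<partial>lborel)"
    using nn_integral_norm_add_sq_le[of "\<lambda>\<xi>. ?t \<xi> - g \<xi>" lborel g ?out] by simp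
  also have "\<dots> \<le> 2 * (2 * ennreal (1/16)) + 2 * ennreal (1/16)"
  proof (intro add_mono mult_left_mono freq)
    have "(\<integral>\<^sup>+ \<xi>. ennreal ((cmod (?t \<xi> - g \<xi>))\<^sup>2) * indicator ?out \<xi> \<partial>lborel)
      \<le> (\<integral>\<^sup>+ \<xi>. ennreal ((cmod (?t \<xi> - g \<xi>))\<^sup>2) \<partial>lborel)"
      by (intro nn_integral_mono) (auto split: split_indicator)
    also have "\<dots> \<le> 2 * ennreal (1/16)"
      by (rule order_trans[OF truncated_fourier_error[OF ft] mult_left_mono[OF time]]) simp
    finally show "(\<integral>\<^sup>+ \<xi>. ennreal ((cmod (?t \<xi> - g \<xi>))\<^sup>2) * indicator ?out \<xi> \<partial>lborel) \<le> 2 * ennreal (1/16)" .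
  qed auto
  also have "\<dots> = ennreal (3/8)"
    by (simp add: ennreal_plus[symmetric] ennreal_mult[symmetric] ennreal_numeral[symmetric] del: ennreal_plus ennreal_numeral)
  finally have out: "(\<integral>\<^sup>+ \<xi>. ennreal ((cmod (?t \<xi>))\<^sup>2) * indicator ?out \<xi> \<partial>lborel) \<le> ennreal (3/8)" .
  have "1 = (\<integral>\<^sup>+ t. ennreal ((cmod (f t))\<^sup>2) * indicator {-T..T} t + ennreal ((cmod (f t))\<^sup>2) * indicator {t. T < \<bar>t\<bar>} t \<partial>lborel)"
    unfolding L2_unit_energy[OF f f1, symmetric]
    by (intro nn_integral_cong) (auto split: split_indicator)
  also have "\<dots> = (\<integral>\<^sup>+ t. ennreal ((cmod (f t))\<^sup>2) * indicator {-T..T} t \<partial>lborel)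
      + (\<integral>\<^sup>+ t. ennreal ((cmod (f t))\<^sup>2) * indicator {t. T < \<bar>t\<bar>} t \<partial>lborel)"
    by (rule nn_integral_add) auto
  also have "(\<integral>\<^sup>+ t. ennreal ((cmod (f t))\<^sup>2) * indicator {-T..T} t \<partial>lborel) = (\<integral>\<^sup>+ \<xi>. ennreal ((cmod (?t \<xi>))\<^sup>2) \<partial>lborel)"
    unfolding truncated_fourier_eq by (rule plancherel_restrict[OF f, symmetric]) auto
  also have "\<dots> = (\<integral>\<^sup>+ \<xi>. ennreal ((cmod (?t \<xi>))\<^sup>2) * indicator {\<xi>. \<bar>\<xi> - b\<bar> \<le> B} \<xi> + ennreal ((cmod (?t \<xi>))\<^sup>2) * indicator ?out \<xi> \<partial>lborel)"
    by (intro nn_integral_cong) (auto split: split_indicator)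
  also have "\<dots> = ?X + (\<integral>\<^sup>+ \<xi>. ennreal ((cmod (?t \<xi>))\<^sup>2) * indicator ?out \<xi> \<partial>lborel)"
    by (rule nn_integral_add) auto
  finally have "1 \<le> ?X + ennreal (3/8) + ennreal (1/16)"
    using add_mono[OF add_mono[OF order_refl out] time, of ?X] by simp
  then show ?thesis
  proof (cases ?X rule: ennreal_cases)
    case (real r)
    with \<open>1 \<le> ?X + ennreal (3/8) + ennreal (1/16)\<close> have "ennreal 1 \<le> ennreal (r + 3/8 + 1/16)"
      by (simp only: ennreal_1 ennreal_plus add_nonneg_nonneg zero_le_divide_iff zero_le_numeral zero_le_one simp_thms)
    then have "1 / 2 \<le> r" using real(1) by (subst (asm) ennreal_le_iff) auto
    then show ?thesis unfolding real(2) by (rule ennreal_leI)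
  qed (simp add: top_unique)
qed

text \<open>The inequality \<open>2 s \<bar>f g\<bar> \<le> s\<^sup>2 \<bar>f\<bar>\<^sup>2 + \<bar>g\<bar>\<^sup>2\<close> is integrated and then optimised over \<open>s\<close>.\<close>
lemma cauchy_schwarz_integral:
  fixes f g :: "'a \<Rightarrow> complex"
  assumes [measurable]: "f \<in> borel_measurable M" "g \<in> borel_measurable M"
    and f2: "integrable M (\<lambda>x. (cmod (f x))\<^sup>2)" and g2: "integrable M (\<lambda>x. (cmod (g x))\<^sup>2)"
  shows "(LINT x|M. cmod (f x * g x))\<^sup>2 \<le> (LINT x|M. (cmod (f x))\<^sup>2) * (LINT x|M. (cmod (g x))\<^sup>2)"
proof -
  define F G C where "F = (LINT x|M. (cmod (f x))\<^sup>2)" and "G = (LINT x|M. (cmod (g x))\<^sup>2)"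
    and "C = (LINT x|M. cmod (f x * g x))"
  have "integrable M (\<lambda>x. f x * cnj (cnj (g x)))"
    by (rule integrable_mult_cnj) (use f2 g2 in auto)
  then have fg: "integrable M (\<lambda>x. cmod (f x * g x))" by simp
  have pos: "0 \<le> F" "0 \<le> G" "0 \<le> C" by (auto simp: F_def G_def C_def)
  have quad: "2 * s * C \<le> s\<^sup>2 * F + G" for s :: real
  proof -
    have "2 * s * C = (LINT x|M. 2 * s * cmod (f x * g x))" by (simp add: C_def)
    also have "\<dots> \<le> (LINT x|M. s\<^sup>2 * (cmod (f x))\<^sup>2 + (cmod (g x))\<^sup>2)"
      using fg f2 g2 sum_squares_bound[of "s * cmod (f _)" "cmod (g _)"]
      by (intro integral_mono) (auto simp: norm_mult power_mult_distrib algebra_simps)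
    also have "\<dots> = s\<^sup>2 * F + G" using f2 g2 by (simp add: F_def G_def)
    finally show ?thesis .
  qed
  have "C\<^sup>2 \<le> F * G"
  proof (cases "F = 0")
    case True
    \<comment> \<open>The quadratic bound has become linear in s, which is impossible for positive C.\<close>
    have "C = 0"
    proof (rule ccontr)
      assume "C \<noteq> 0"
      then show False using quad[of "(G + 1) / C"] pos True by simp
    qed
    then show ?thesis using pos by simp
  next
    case False
    then have "0 < F" using pos by simp
    then have "C\<^sup>2 / F \<le> G" using quad[of "C / F"] by (simp add: power2_eq_square field_simps)
    then show ?thesis using \<open>0 < F\<close> by (simp add: field_simps)
  qed
  then show ?thesis by (simp add: F_def G_def C_def)
qed

text \<open>For truncations of \<open>f\<close> this is the multiplication formula. On the left the limit is one of dominated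
  convergence, since the transform of \<open>u\<close> is square-integrable; on the right it is the convergence
  in \<open>L\<^sup>2\<close> that defines \<open>g\<close>.\<close>
lemma parseval_formula:
  assumes ft: "has_L2_fourier_transform f g"
    and u1: "integrable lborel u" and u2: "integrable lborel (\<lambda>t. (cmod (u t))\<^sup>2)"
  shows "(LINT t|lborel. f t * fourier u t) = (LINT \<xi>|lborel. u \<xi> * g \<xi>)"
proof (rule LIMSEQ_unique)
  have f: "f \<in> L2" and g: "g \<in> L2"
    and lim: "((\<lambda>R. \<integral>\<^sup>+ \<xi>. ennreal ((cmod (truncated_fourier R f \<xi> - g \<xi>))\<^sup>2) \<partial>lborel) \<longlongrightarrow> 0) at_top"
    using ft by (auto simp: has_L2_fourier_transform_def)
  note [measurable] = L2_D(1)[OF f] L2_D(1)[OF g]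
  have [measurable]: "u \<in> borel_measurable borel" using u1 by auto
  have tm [measurable]: "truncated_fourier R f \<in> borel_measurable borel" for R
    unfolding truncated_fourier_eq by measurable
  have "(\<integral>\<^sup>+ t. ennreal ((cmod (fourier u t))\<^sup>2) \<partial>lborel) < \<infinity>"
    unfolding plancherel[OF u1 u2] by simp
  then have hu2: "integrable lborel (\<lambda>t. (cmod (fourier u t))\<^sup>2)"
    by (intro integrableI_nonneg) auto
  have "integrable lborel (\<lambda>t. f t * cnj (cnj (fourier u t)))"
    by (rule integrable_mult_cnj) (use L2_D[OF f] hu2 in auto)
  then have fu: "integrable lborel (\<lambda>t. f t * fourier u t)" by simp
  let ?F = "\<lambda>n. restrict_to {-real n..real n} f"
  show "(\<lambda>n. LINT t|lborel. ?F n t * fourier u t) \<longlonglongrightarrow> (LINT t|lborel. f t * fourier u t)"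
  proof (rule integral_dominated_convergence)
    show "integrable lborel (\<lambda>t. cmod (f t * fourier u t))" using fu by (rule integrable_norm)
    show "AE t in lborel. (\<lambda>n. ?F n t * fourier u t) \<longlonglongrightarrow> f t * fourier u t"
    proof (intro AE_I2 tendsto_eventually)
      fix t :: real
      show "\<forall>\<^sub>F n in sequentially. ?F n t * fourier u t = f t * fourier u t"
        using eventually_ge_at_top[of "nat \<lceil>\<bar>t\<bar>\<rceil>"]
        by eventually_elim (auto simp: restrict_to_def split: split_indicator)
    qed
    show "AE t in lborel. norm (?F n t * fourier u t) \<le> cmod (f t * fourier u t)" for n
      by (intro AE_I2) (auto simp: restrict_to_def split: split_indicator)
  qed (use fu in auto)
  define E where "E n = (LINT \<xi>|lborel. (cmod (truncated_fourier (real n) f \<xi> - g \<xi>))\<^sup>2)" for n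
  have limn: "(\<lambda>n. \<integral>\<^sup>+ \<xi>. ennreal ((cmod (truncated_fourier (real n) f \<xi> - g \<xi>))\<^sup>2) \<partial>lborel) \<longlonglongrightarrow> 0"
    using filterlim_compose[OF lim filterlim_real_sequentially] .
  have T2: "integrable lborel (\<lambda>\<xi>. (cmod (truncated_fourier (real n) f \<xi>))\<^sup>2)" for n
  proof (rule integrableI_nonneg)
    have "(\<integral>\<^sup>+ \<xi>. ennreal ((cmod (truncated_fourier (real n) f \<xi>))\<^sup>2) \<partial>lborel)
      = ennreal (LINT t|lborel. (cmod (?F n t))\<^sup>2)"
      unfolding truncated_fourier_eq
      by (rule plancherel[OF integrable_restrict[OF f _ order_refl] integrable_sq_restrict[OF f]]) auto
    then show "(\<integral>\<^sup>+ \<xi>. ennreal ((cmod (truncated_fourier (real n) f \<xi>))\<^sup>2) \<partial>lborel) < \<infinity>" by simp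
  qed auto
  have d2: "integrable lborel (\<lambda>\<xi>. (cmod (truncated_fourier (real n) f \<xi> - g \<xi>))\<^sup>2)" for n
  proof (rule Bochner_Integration.integrable_bound)
    show "integrable lborel (\<lambda>\<xi>. 2 * (cmod (truncated_fourier (real n) f \<xi>))\<^sup>2 + 2 * (cmod (g \<xi>))\<^sup>2)"
      using T2 L2_D[OF g] by simp
    show "AE \<xi> in lborel. norm ((cmod (truncated_fourier (real n) f \<xi> - g \<xi>))\<^sup>2)
      \<le> norm (2 * (cmod (truncated_fourier (real n) f \<xi>))\<^sup>2 + 2 * (cmod (g \<xi>))\<^sup>2)"
      using norm_add_sq_le[of "truncated_fourier (real n) f _" "- g _"] by (intro AE_I2) simp
  qed simp
  have E0: "0 \<le> E n" for n by (simp add: E_def)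
  have "(\<lambda>n. ennreal (E n)) \<longlonglongrightarrow> ennreal 0"
    using limn by (simp add: E_def nn_integral_eq_integral[OF d2])
  then have E: "E \<longlonglongrightarrow> 0" using E0 by (subst (asm) tendsto_ennreal_iff) auto
  show "(\<lambda>n. LINT t|lborel. ?F n t * fourier u t) \<longlonglongrightarrow> (LINT \<xi>|lborel. u \<xi> * g \<xi>)"
  proof (rule LIM_zero_cancel, rule Lim_null_comparison)
    let ?U = "LINT t|lborel. (cmod (u t))\<^sup>2"
    show "(\<lambda>n. sqrt (?U * E n)) \<longlonglongrightarrow> 0"
      using tendsto_real_sqrt[OF tendsto_mult_right_zero[OF E, of ?U]] by simp
    have "norm ((LINT t|lborel. ?F n t * fourier u t) - (LINT \<xi>|lborel. u \<xi> * g \<xi>)) \<le> sqrt (?U * E n)" for n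
    proof -
      have mult: "(LINT t|lborel. ?F n t * fourier u t) = (LINT \<xi>|lborel. u \<xi> * truncated_fourier (real n) f \<xi>)"
        using fourier_multiplication[OF integrable_restrict[OF f _ order_refl, of "-real n" "real n"] u1]
        by (simp add: truncated_fourier_eq mult.commute)
      have ug: "integrable lborel (\<lambda>\<xi>. u \<xi> * cnj (cnj (g \<xi>)))"
        by (rule integrable_mult_cnj) (use u2 L2_D[OF g] in auto)
      have ut: "integrable lborel (\<lambda>\<xi>. u \<xi> * cnj (cnj (truncated_fourier (real n) f \<xi>)))"
        by (rule integrable_mult_cnj) (use u2 T2 in auto)
      have "norm ((LINT t|lborel. ?F n t * fourier u t) - (LINT \<xi>|lborel. u \<xi> * g \<xi>))
        = norm (LINT \<xi>|lborel. u \<xi> * (truncated_fourier (real n) f \<xi> - g \<xi>))"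
        using ug ut by (simp add: mult right_diff_distrib)
      also have "\<dots> \<le> (LINT \<xi>|lborel. norm (u \<xi> * (truncated_fourier (real n) f \<xi> - g \<xi>)))"
        by (rule integral_norm_bound)
      also have "\<dots> \<le> sqrt (?U * E n)"
        unfolding E_def by (intro real_le_rsqrt cauchy_schwarz_integral u2 d2) auto
      finally show ?thesis .
    qed
    then show "\<forall>\<^sub>F n in sequentially. norm ((LINT t|lborel. ?F n t * fourier u t) - (LINT \<xi>|lborel. u \<xi> * g \<xi>)) \<le> sqrt (?U * E n)"
      by simp
  qed
qed

section \<open>Summability of the frequency weights\<close>

lemma nn_integral_powr_weight_finite:
  fixes q :: real
  assumes "1 < q"
  shows "(\<integral>\<^sup>+ \<xi>. ennreal ((1 + \<bar>\<xi>\<bar>) powr (- q)) \<partial>lborel) < \<infinity>"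
proof -
  let ?w = "\<lambda>\<xi>::real. ennreal ((1 + \<bar>\<xi>\<bar>) powr (- q))"
  let ?F = "\<lambda>x. (1 + x) powr (1 - q) / (1 - q)"
  have "(\<integral>\<^sup>+ x. ennreal ((1 + \<bar>x\<bar>) powr (- q)) * indicator {0..} x \<partial>lborel) = ennreal (0 - ?F 0)"
  proof (rule nn_integral_FTC_atLeast)
    show "(?F has_real_derivative (1 + \<bar>x\<bar>) powr - q) (at x)" if "0 \<le> x" for x
      using that assms by (auto intro!: derivative_eq_intros)
    have "((\<lambda>x. (1 + x) powr (1 - q)) \<longlongrightarrow> 0) at_top"
      using assms by (intro tendsto_neg_powr filterlim_tendsto_add_at_top[OF tendsto_const] filterlim_ident) auto
    from tendsto_divide[OF this tendsto_const[of "1 - q"]] assms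
    show "(?F \<longlongrightarrow> 0) at_top" by simp
  qed auto
  then have half: "(\<integral>\<^sup>+ x. ?w x * indicator {0..} x \<partial>lborel) < \<infinity>" by simp
  have refl: "(\<integral>\<^sup>+ x. ?w x * indicator {..0} x \<partial>lborel) = (\<integral>\<^sup>+ x. ?w x * indicator {0..} x \<partial>lborel)"
    by (subst nn_integral_real_affine[where c="-1" and t=0]) (auto intro!: nn_integral_cong split: split_indicator)
  have "(\<integral>\<^sup>+ x. ?w x \<partial>lborel) \<le> (\<integral>\<^sup>+ x. ?w x * indicator {0..} x + ?w x * indicator {..0} x \<partial>lborel)"
    by (intro nn_integral_mono) (auto split: split_indicator)
  also have "\<dots> = (\<integral>\<^sup>+ x. ?w x * indicator {0..} x \<partial>lborel) + (\<integral>\<^sup>+ x. ?w x * indicator {..0} x \<partial>lborel)"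
    by (rule nn_integral_add) auto
  also have "\<dots> < \<infinity>" using half refl by simp
  finally show ?thesis .
qed

text \<open>The test vector is the exponential of frequency \<open>\<xi>\<close> cut off to \<open>[-T, T]\<close>.\<close>
lemma bessel_truncated_fourier:
  assumes bessel: "\<And>f. f \<in> L2 \<Longrightarrow> (\<Sum>n. ennreal ((cmod (L2_inner f (e n)))\<^sup>2)) \<le> ennreal (\<beta> * (L2_norm f)\<^sup>2)"
    and T: "0 \<le> T"
  shows "(\<Sum>n. ennreal ((cmod (truncated_fourier T (e n) \<xi>))\<^sup>2)) \<le> ennreal (\<beta> * (2 * T))"
proof -
  define h where "h = restrict_to {-T..T} (\<lambda>t. cnj (phase (t * \<xi>)))"
  have [measurable]: "h \<in> borel_measurable borel"
    unfolding h_def by (intro restrict_to_measurable) auto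
  have n2: "(cmod (h t))\<^sup>2 = indicat_real {-T..T} t" for t
    by (simp add: h_def norm_restrict_to split: split_indicator)
  have h: "h \<in> L2" by (simp add: L2_def n2 integrable_indicator_iff emeasure_lborel_Icc_eq)
  have hn: "(L2_norm h)\<^sup>2 = 2 * T" using T by (simp add: L2_norm_def n2)
  have "L2_inner h (e n) = cnj (truncated_fourier T (e n) \<xi>)" for n
    unfolding truncated_fourier_eq fourier_def L2_inner_def Bochner_Integration.integral_cnj[symmetric]
    by (intro Bochner_Integration.integral_cong) (auto simp: h_def restrict_to_def)
  then show ?thesis using bessel[OF h] by (simp add: hn)
qed

text \<open>The bound of \<open>bessel_truncated_fourier\<close>, uniform in \<open>\<xi>\<close>, is integrated against the weight. On the interval of radius
  \<open>B\<close> about \<open>b n\<close> the weight is comparable to its value at \<open>b n\<close>, so the \<open>n\<close>-th term contributes at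
  least a fixed multiple of that value.\<close>
lemma summable_frequency_weights:
  assumes bessel: "\<And>f. f \<in> L2 \<Longrightarrow> (\<Sum>n. ennreal ((cmod (L2_inner f (e n)))\<^sup>2)) \<le> ennreal (\<beta> * (L2_norm f)\<^sup>2)"
    and "0 \<le> T" "0 \<le> B" "1 < q"
    and e: "\<And>n. e n \<in> L2"
    and energy: "\<And>n. ennreal (1/2) \<le> (\<integral>\<^sup>+ \<xi>. ennreal ((cmod (truncated_fourier T (e n) \<xi>))\<^sup>2) * indicator {\<xi>. \<bar>\<xi> - b n\<bar> \<le> B} \<xi> \<partial>lborel)"
  shows "summable (\<lambda>n. (1 + \<bar>b n\<bar>) powr (- q))"
proof -
  note [measurable] = L2_D(1)[OF e]
  have [measurable]: "truncated_fourier T (e n) \<in> borel_measurable borel" for n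
    unfolding truncated_fourier_eq by measurable
  let ?w = "\<lambda>\<xi>::real. (1 + \<bar>\<xi>\<bar>) powr (- q)"
  let ?t = "\<lambda>n \<xi>. ennreal ((cmod (truncated_fourier T (e n) \<xi>))\<^sup>2)"
  define k where "k = (1 + B) powr (- q) / 2"
  have k: "0 < k" using \<open>0 \<le> B\<close> by (simp add: k_def)
  have w: "(1 + B) powr (- q) * ?w (b n) \<le> ?w \<xi>" if "\<bar>\<xi> - b n\<bar> \<le> B" for n \<xi>
  proof -
    have "1 + \<bar>\<xi>\<bar> \<le> 1 + \<bar>b n\<bar> + B" using that by linarith
    also have "\<dots> \<le> (1 + B) * (1 + \<bar>b n\<bar>)" using \<open>0 \<le> B\<close> by (simp add: algebra_simps)
    finally have "((1 + B) * (1 + \<bar>b n\<bar>)) powr (- q) \<le> ?w \<xi>"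
      using \<open>1 < q\<close> by (intro powr_mono2') auto
    then show ?thesis by (simp add: powr_mult)
  qed
  have lower: "ennreal (k * ?w (b n)) \<le> (\<integral>\<^sup>+ \<xi>. ennreal (?w \<xi>) * ?t n \<xi> \<partial>lborel)" for n
  proof -
    let ?c = "(1 + B) powr (- q) * ?w (b n)"
    have "ennreal (k * ?w (b n)) = ennreal ?c * ennreal (1/2)"
      by (subst ennreal_mult[symmetric]) (auto simp: k_def)
    also have "\<dots> \<le> ennreal ?c * (\<integral>\<^sup>+ \<xi>. ?t n \<xi> * indicator {\<xi>. \<bar>\<xi> - b n\<bar> \<le> B} \<xi> \<partial>lborel)"
      by (intro mult_left_mono energy) simp
    also have "\<dots> = (\<integral>\<^sup>+ \<xi>. ennreal ?c * (?t n \<xi> * indicator {\<xi>. \<bar>\<xi> - b n\<bar> \<le> B} \<xi>) \<partial>lborel)"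
      by (rule nn_integral_cmult[symmetric]) measurable
    also have "\<dots> \<le> (\<integral>\<^sup>+ \<xi>. ennreal (?w \<xi>) * ?t n \<xi> \<partial>lborel)"
      by (intro nn_integral_mono) (auto split: split_indicator intro!: mult_right_mono ennreal_leI w)
    finally show ?thesis .
  qed
  have "(\<Sum>n. ennreal (k * ?w (b n))) \<le> (\<Sum>n. \<integral>\<^sup>+ \<xi>. ennreal (?w \<xi>) * ?t n \<xi> \<partial>lborel)"
    by (intro suminf_le lower) auto
  also have "\<dots> = (\<integral>\<^sup>+ \<xi>. (\<Sum>n. ennreal (?w \<xi>) * ?t n \<xi>) \<partial>lborel)"
    by (rule nn_integral_suminf[symmetric]) measurable
  also have "\<dots> \<le> (\<integral>\<^sup>+ \<xi>. ennreal (?w \<xi>) * ennreal (\<beta> * (2 * T)) \<partial>lborel)"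
    unfolding ennreal_suminf_cmult
    by (intro nn_integral_mono mult_left_mono bessel_truncated_fourier bessel \<open>0 \<le> T\<close>) simp_all
  also have "\<dots> = (\<integral>\<^sup>+ \<xi>. ennreal (?w \<xi>) \<partial>lborel) * ennreal (\<beta> * (2 * T))"
    by (rule nn_integral_multc) measurable
  also have "\<dots> < \<infinity>"
    using nn_integral_powr_weight_finite[OF \<open>1 < q\<close>] by (simp add: ennreal_mult_less_top)
  finally have "(\<Sum>n. ennreal (k * ?w (b n))) \<noteq> top" by simp
  then have "summable (\<lambda>n. k * ?w (b n))"
    using k by (intro summable_suminf_not_top) auto
  then show ?thesis using k by (simp add: summable_cmult_iff)
qed

section \<open>Test signals that escape to infinity in time\<close>

text \<open>The conjugate of the Fourier transform of the test signal below. The frequency is \<open>m + 1\<close> because the half-period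
  shift in the Riemann-Lebesgue lemma needs a nonzero frequency.\<close>
definition test_spectrum :: "nat \<Rightarrow> real \<Rightarrow> complex" where
  "test_spectrum m = restrict_to {0..1} (\<lambda>\<xi>. phase (\<xi> * real (Suc m)))"

text \<open>The translate by \<open>-(m+1)\<close> of the inverse transform of the indicator of
  \<open>[0, 1]\<close>. It is written as a conjugate so that Plancherel's theorem and Parseval's formula
  apply without a reflection of the variable.\<close>
definition test_signal :: "nat \<Rightarrow> real \<Rightarrow> complex" where
  "test_signal m t = cnj (fourier (test_spectrum m) t)"

lemma test_spectrum_integrable:
  "integrable lborel (test_spectrum m)" "integrable lborel (\<lambda>\<xi>. (cmod (test_spectrum m \<xi>))\<^sup>2)"
  "(LINT \<xi>|lborel. (cmod (test_spectrum m \<xi>))\<^sup>2) = 1"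
proof -
  have [measurable]: "test_spectrum m \<in> borel_measurable borel"
    unfolding test_spectrum_def by (intro restrict_to_measurable) auto
  have 1: "integrable lborel (indicat_real {0..1::real})" by (simp add: integrable_indicator_iff emeasure_lborel_Icc_eq)
  have n: "cmod (test_spectrum m \<xi>) = indicat_real {0..1} \<xi>" for \<xi>
    by (simp add: test_spectrum_def norm_restrict_to)
  have n2: "(cmod (test_spectrum m \<xi>))\<^sup>2 = indicat_real {0..1} \<xi>" for \<xi>
    by (simp add: n split: split_indicator)
  show "integrable lborel (test_spectrum m)"
    by (rule Bochner_Integration.integrable_bound[OF 1]) (auto simp: n)
  show "integrable lborel (\<lambda>\<xi>. (cmod (test_spectrum m \<xi>))\<^sup>2)" unfolding n2 by (rule 1)
  show "(LINT \<xi>|lborel. (cmod (test_spectrum m \<xi>))\<^sup>2) = 1" unfolding n2 by simp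
qed

lemma test_signal_L2: "test_signal m \<in> L2" "L2_norm (test_signal m) = 1"
proof -
  have [measurable]: "fourier (test_spectrum m) \<in> borel_measurable borel"
    using test_spectrum_integrable(1)[of m] by (intro fourier_measurable) auto
  have e: "(\<integral>\<^sup>+ t. ennreal ((cmod (test_signal m t))\<^sup>2) \<partial>lborel) = ennreal 1"
    using plancherel[OF test_spectrum_integrable(1,2)[of m]] by (simp add: test_signal_def test_spectrum_integrable(3))
  have meas [measurable]: "test_signal m \<in> borel_measurable borel"
    unfolding test_signal_def[abs_def] by measurable
  have "integrable lborel (\<lambda>t. (cmod (test_signal m t))\<^sup>2)"
    using e by (intro integrableI_nonneg) auto
  then show "test_signal m \<in> L2" by (simp add: L2_def)
  have "(LINT t|lborel. (cmod (test_signal m t))\<^sup>2) = 1"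
    by (rule integral_eq_nn_integral[THEN trans]) (auto simp: e)
  then show "L2_norm (test_signal m) = 1" by (simp add: L2_norm_def)
qed

lemma test_signal_coefficient:
  assumes ft: "has_L2_fourier_transform f g"
  shows "L2_inner (test_signal m) f = cnj (fourier (restrict_to {0..1} g) (real (Suc m)))"
proof -
  have "L2_inner (test_signal m) f = (LINT t|lborel. cnj (f t * fourier (test_spectrum m) t))"
    by (simp add: L2_inner_def test_signal_def mult.commute)
  also have "\<dots> = cnj (LINT t|lborel. f t * fourier (test_spectrum m) t)"
    by (rule Bochner_Integration.integral_cnj)
  also have "(LINT t|lborel. f t * fourier (test_spectrum m) t) = (LINT \<xi>|lborel. test_spectrum m \<xi> * g \<xi>)"
    by (rule parseval_formula[OF ft test_spectrum_integrable(1,2)])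
  also have "\<dots> = fourier (restrict_to {0..1} g) (real (Suc m))"
    unfolding fourier_def by (intro Bochner_Integration.integral_cong) (auto simp: test_spectrum_def restrict_to_def)
  finally show ?thesis .
qed

text \<open>By Cauchy-Schwarz the coefficient is controlled by the energy of \<open>g\<close> on \<open>[0, 1]\<close>. There \<open>1 + \<bar>b\<bar>\<close> is
  at most \<open>3 max(1, \<bar>\<xi> - b\<bar>)\<close>, so the \<open>q\<close>-moment about \<open>b\<close> bounds that energy.\<close>
lemma test_signal_coefficient_bound:
  assumes ft: "has_L2_fourier_transform f g" and f1: "L2_norm f = 1" and q: "0 \<le> q"
    and M: "moment q g b \<le> ennreal M" "0 \<le> M"
  shows "(cmod (L2_inner (test_signal m) f))\<^sup>2 \<le> 3 powr q * (6 + M) * (1 + \<bar>b\<bar>) powr (- q)"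
proof -
  have g: "g \<in> L2" using ft by (auto simp: has_L2_fourier_transform_def)
  note [measurable] = L2_D(1)[OF g]
  let ?r = "restrict_to {0..1} g"
  let ?P = "LINT \<xi>|lborel. (cmod (?r \<xi>))\<^sup>2"
  have i1: "integrable lborel (indicat_real {0..1::real})" by (simp add: integrable_indicator_iff emeasure_lborel_Icc_eq)
  have r2: "integrable lborel (\<lambda>\<xi>. (cmod (?r \<xi>))\<^sup>2)" by (rule integrable_sq_restrict[OF g]) simp
  have ind2: "(cmod (complex_of_real (indicat_real {0..1} \<xi>)))\<^sup>2 = indicat_real {0..1} \<xi>" for \<xi> :: real
    by (simp split: split_indicator)
  have indr: "complex_of_real (indicat_real {0..1} \<xi>) * ?r \<xi> = ?r \<xi>" for \<xi>
    by (simp add: restrict_to_def split: split_indicator)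
  have "(LINT \<xi>|lborel. cmod (?r \<xi>))\<^sup>2 \<le> ?P"
    using cauchy_schwarz_integral[of "\<lambda>\<xi>. complex_of_real (indicat_real {0..1} \<xi>)" lborel ?r] r2 i1
    unfolding ind2 indr by simp
  moreover have "(cmod (L2_inner (test_signal m) f))\<^sup>2 \<le> (LINT \<xi>|lborel. cmod (?r \<xi>))\<^sup>2"
    unfolding test_signal_coefficient[OF ft] complex_mod_cnj by (intro power_mono norm_fourier_le) simp
  moreover have "?P \<le> 3 powr q * (6 + M) * (1 + \<bar>b\<bar>) powr (- q)"
  proof -
    have pt: "(1 + \<bar>b\<bar>) powr q * (cmod (?r \<xi>))\<^sup>2 \<le> 3 powr q * ((cmod (g \<xi>))\<^sup>2 + \<bar>\<xi> - b\<bar> powr q * (cmod (g \<xi>))\<^sup>2)" for \<xi>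
    proof (cases "\<xi> \<in> {0..1}")
      case True
      have "1 + \<bar>b\<bar> \<le> 3 * max 1 \<bar>\<xi> - b\<bar>"
        using abs_triangle_ineq[of \<xi> "b - \<xi>"] True by (simp add: abs_minus_commute max_def)
      then have "(1 + \<bar>b\<bar>) powr q \<le> (3 * max 1 \<bar>\<xi> - b\<bar>) powr q"
        using q by (intro powr_mono2) auto
      also have "\<dots> = 3 powr q * max 1 \<bar>\<xi> - b\<bar> powr q" by (rule powr_mult)
      also have "\<dots> \<le> 3 powr q * (1 + \<bar>\<xi> - b\<bar> powr q)"
        by (intro mult_left_mono) (auto simp: max_def)
      finally have "(1 + \<bar>b\<bar>) powr q * (cmod (g \<xi>))\<^sup>2 \<le> 3 powr q * (1 + \<bar>\<xi> - b\<bar> powr q) * (cmod (g \<xi>))\<^sup>2"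
        by (rule mult_right_mono) simp
      then show ?thesis using True by (simp add: norm_restrict_to algebra_simps)
    qed (simp add: norm_restrict_to)
    have "ennreal ((1 + \<bar>b\<bar>) powr q * ?P) = (\<integral>\<^sup>+ \<xi>. ennreal ((1 + \<bar>b\<bar>) powr q * (cmod (?r \<xi>))\<^sup>2) \<partial>lborel)"
      by (subst nn_integral_eq_integral) (use r2 in auto)
    also have "\<dots> \<le> (\<integral>\<^sup>+ \<xi>. ennreal (3 powr q) * (ennreal ((cmod (g \<xi>))\<^sup>2) + ennreal (\<bar>\<xi> - b\<bar> powr q * (cmod (g \<xi>))\<^sup>2)) \<partial>lborel)"
    proof (rule nn_integral_mono)
      fix \<xi>
      have "ennreal (3 powr q * ((cmod (g \<xi>))\<^sup>2 + \<bar>\<xi> - b\<bar> powr q * (cmod (g \<xi>))\<^sup>2))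
        = ennreal (3 powr q) * (ennreal ((cmod (g \<xi>))\<^sup>2) + ennreal (\<bar>\<xi> - b\<bar> powr q * (cmod (g \<xi>))\<^sup>2))"
        by (subst ennreal_mult) (auto intro: ennreal_plus)
      with ennreal_leI[OF pt[of \<xi>]]
      show "ennreal ((1 + \<bar>b\<bar>) powr q * (cmod (?r \<xi>))\<^sup>2)
        \<le> ennreal (3 powr q) * (ennreal ((cmod (g \<xi>))\<^sup>2) + ennreal (\<bar>\<xi> - b\<bar> powr q * (cmod (g \<xi>))\<^sup>2))" 
        by (rule ord_le_eq_trans)
    qed
    also have "\<dots> = ennreal (3 powr q) * ((\<integral>\<^sup>+ \<xi>. ennreal ((cmod (g \<xi>))\<^sup>2) \<partial>lborel) + moment q g b)"
      unfolding moment_def by (simp add: nn_integral_cmult nn_integral_add)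
    also have "\<dots> \<le> ennreal (3 powr q) * (6 + ennreal M)"
      by (intro mult_left_mono add_mono fourier_transform_energy_le[OF ft f1] M) simp
    also have "\<dots> = ennreal (3 powr q * (6 + M))"
      using M(2) by (simp add: ennreal_mult)
    finally have "(1 + \<bar>b\<bar>) powr q * ?P \<le> 3 powr q * (6 + M)" using M(2) by (subst (asm) ennreal_le_iff) auto
    then show ?thesis by (simp add: powr_minus field_simps)
  qed
  ultimately show ?thesis by linarith
qed

lemma test_signal_coefficient_tendsto:
  assumes ft: "has_L2_fourier_transform f g"
  shows "(\<lambda>m. (cmod (L2_inner (test_signal m) f))\<^sup>2) \<longlonglongrightarrow> 0"
proof -
  have g: "g \<in> L2" using ft by (auto simp: has_L2_fourier_transform_def)
  have "integrable lborel (restrict_to {0..1} g)" by (rule integrable_restrict[OF g _ order_refl]) simp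
  from tendsto_power[OF tendsto_norm[OF riemann_lebesgue[OF this]], of 2]
  show ?thesis unfolding test_signal_coefficient[OF ft] complex_mod_cnj by simp
qed

section \<open>Bounded time-frequency spread contradicts the frame property\<close>

theorem corollary4p4:
  fixes A p q :: real
    and e e_hat :: "nat \<Rightarrow> real \<Rightarrow> complex"
  assumes "A > 0" and "p > 1" and "q > 1"
    and "\<And>n. e n \<in> L2"
    and "\<And>n. L2_norm (e n) = 1"
    and "\<And>n. has_L2_fourier_transform (e n) (e_hat n)"
    and "\<And>n. \<bar>p_mean p (e n)\<bar> \<le> A"
    and "\<And>n. dispersion p (e n) \<le> ennreal A"
    and "\<And>n. dispersion q (e_hat n) \<le> ennreal A"
  shows "\<not> L2_frame e"
proof
  assume "L2_frame e"
  then obtain \<alpha> \<beta> where \<alpha>: "0 < \<alpha>"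
    and lower: "\<And>f. f \<in> L2 \<Longrightarrow> ennreal (\<alpha> * (L2_norm f)\<^sup>2) \<le> (\<Sum>n. ennreal ((cmod (L2_inner f (e n)))\<^sup>2))"
    and bessel: "\<And>f. f \<in> L2 \<Longrightarrow> (\<Sum>n. ennreal ((cmod (L2_inner f (e n)))\<^sup>2)) \<le> ennreal (\<beta> * (L2_norm f)\<^sup>2)"
    unfolding L2_frame_def by blast
  note ft = assms(6)
  have e_hat: "e_hat n \<in> L2" for n using ft[of n] by (simp add: has_L2_fourier_transform_def)
  \<comment> \<open>The slack factor 2 gives a nearly optimal centre without any appeal to attainment.\<close>
  have "\<exists>b. moment q (e_hat n) b \<le> ennreal ((2 * A)\<^sup>2)" for n
  proof -
    have "dispersion q (e_hat n) < ennreal (2 * A)"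
      by (rule order_le_less_trans[OF assms(9)]) (use \<open>A > 0\<close> in \<open>simp add: ennreal_lessI\<close>)
    then obtain b where "dispersion_about q (e_hat n) b < ennreal (2 * A)"
      unfolding dispersion_def INF_less_iff by auto
    then show ?thesis using \<open>A > 0\<close> by (intro exI[of _ b] moment_le_square less_imp_le) auto
  qed
  then obtain b where b: "\<And>n. moment q (e_hat n) (b n) \<le> ennreal ((2 * A)\<^sup>2)" by metis
  \<comment> \<open>The centres p_mean p (e n) lie in [-A, A], so A is added to the radius about the centre.\<close>
  define T where "T = A + (16 * A\<^sup>2) powr (1 / p)"
  define B where "B = (16 * (2 * A)\<^sup>2) powr (1 / q)"
  have freq: "(\<integral>\<^sup>+ \<xi>. ennreal ((cmod (e_hat n \<xi>))\<^sup>2) * indicator {\<xi>. B < \<bar>\<xi> - b n\<bar>} \<xi> \<partial>lborel) \<le> ennreal (1/16)" for n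
    unfolding B_def by (rule uniform_tail[OF L2_D(1)[OF e_hat] _ _ b]) (use assms(1,3) in auto)
  have time: "(\<integral>\<^sup>+ t. ennreal ((cmod (e n t))\<^sup>2) * indicator {t. T < \<bar>t\<bar>} t \<partial>lborel) \<le> ennreal (1/16)" for n
  proof -
    have fin: "dispersion p (e n) < \<infinity>" by (rule order_le_less_trans[OF assms(8)]) simp
    have "moment p (e n) (p_mean p (e n)) \<le> ennreal (A\<^sup>2)"
      by (rule moment_le_square)
        (use dispersion_about_p_mean[OF assms(4,5,2) fin] assms(1,8) in auto)
    then have "(\<integral>\<^sup>+ t. ennreal ((cmod (e n t))\<^sup>2) * indicator {t. (16 * A\<^sup>2) powr (1 / p) < \<bar>t - p_mean p (e n)\<bar>} t \<partial>lborel) \<le> ennreal (1/16)"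
      by (intro uniform_tail L2_D(1) assms(4)) (use assms(1,2) in auto)
    moreover have "(16 * A\<^sup>2) powr (1 / p) < \<bar>t - p_mean p (e n)\<bar>" if "T < \<bar>t\<bar>" for t
      using assms(7)[of n] that by (simp add: T_def)
    ultimately show ?thesis
      by (elim order_trans[rotated], intro nn_integral_mono) (auto split: split_indicator)
  qed
  have "0 \<le> T" "0 \<le> B" using \<open>A > 0\<close> by (auto simp: T_def B_def)
  have "summable (\<lambda>n. (1 + \<bar>b n\<bar>) powr (- q))"
    by (rule summable_frequency_weights[OF bessel \<open>0 \<le> T\<close> \<open>0 \<le> B\<close> \<open>q > 1\<close> assms(4)
        local_energy_ge_half[OF ft assms(5) time freq]])
  define C where "C = 3 powr q * (6 + (2 * A)\<^sup>2)"
  let ?c = "\<lambda>n m. (cmod (L2_inner (test_signal m) (e n)))\<^sup>2"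
  have dom: "?c n m \<le> C * (1 + \<bar>b n\<bar>) powr (- q)" for n m
    unfolding C_def by (rule test_signal_coefficient_bound[OF ft assms(5) _ b]) (use \<open>q > 1\<close> in auto)
  have sumC: "summable (\<lambda>n. C * (1 + \<bar>b n\<bar>) powr (- q))"
    using \<open>summable _\<close> by (rule summable_mult)
  have summable: "summable (\<lambda>n. ?c n m)" for m
    by (rule summable_comparison_test'[OF sumC, of 0]) (simp add: dom)
  have "((\<lambda>m. suminf (\<lambda>n. ?c n m)) \<longlongrightarrow> suminf (\<lambda>n. 0)) sequentially"
    by (rule tannerys_theorem[THEN conjunct2, THEN conjunct2, OF test_signal_coefficient_tendsto[OF ft] _ sumC])
      (auto simp: dom intro!: always_eventually)
  moreover have "\<alpha> \<le> suminf (\<lambda>n. ?c n m)" for m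
  proof -
    have "ennreal \<alpha> \<le> (\<Sum>n. ennreal (?c n m))"
      using lower[OF test_signal_L2(1), of m] by (simp add: test_signal_L2(2))
    also have "\<dots> = ennreal (suminf (\<lambda>n. ?c n m))"
      by (rule suminf_ennreal2[OF _ summable]) simp
    finally show ?thesis using suminf_nonneg[OF summable] by (simp add: ennreal_le_iff)
  qed
  ultimately have "\<alpha> \<le> suminf (\<lambda>n. 0 :: real)"
    by (intro tendsto_lowerbound[OF _ _ trivial_limit_sequentially]) auto
  then show False using \<alpha> by simp
qed

end
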